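(* Let $Y$ be a finite-dimensional real Banach space with $\dim Y\ge1$. The map $\mathbf{E}(Y)\to\mathscr{K}(Y,\operatorname{Hom}(Y,\mathbf{R}))$, $\gamma\mapsto \mathrm{D}\gamma$, is a homeomorphic embedding. Furthermore, the subsets $W_\alpha$ of $\mathbf{E}(Y)$, corresponding to each function $\alpha$ from the positive integers to the positive integers, where $W_\alpha$ consists of all $\gamma\in\mathbf{E}(Y)$ satisfying $$\|\mathrm{D}\gamma(y)\|\le\alpha(i)^{-1}\quad\text{whenever } i \text{ is a positive integer and } |y|>i-1,$$ form a fundamental system of neighborhoods of $0$ in $\mathbf{E}(Y)$.
   Context: For $0\le s<\infty$, $\mathbf{E}_s(Y)$ is the space of continuously differentiable functions $\gamma:Y\to\mathbf{R}$ with $\gamma(0)=0$ and $\operatorname{spt}\mathrm{D}\gamma\subset\mathbf{B}(0,s)$ (closed ball), normed by $\gamma\mapsto\sup_{y\in Y}\|\mathrm{D}\gamma(y)\|$. The vector space $\mathbf{E}(Y)=\bigcup_{0\le s<\infty}\mathbf{E}_s(Y)$ carries the finest locally convex topology for which all inclusions $\mathbf{E}_s(Y)\to\mathbf{E}(Y)$ are continuous. For a locally compact Hausdorff space $X$ and a normed space $Z$, $\mathscr{K}_K(X,Z)$ is the space of continuous functions $X\to Z$ with support in the compact set $K\subset X$, with the supremum norm, and $\mathscr{K}(X,Z)=\bigcup_K\mathscr{K}_K(X,Z)$ carries the finest locally convex topology for which all inclusions $\mathscr{K}_K(X,Z)\to\mathscr{K}(X,Z)$ are continuous. $\operatorname{Hom}(Y,\mathbf{R})$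 has the operator norm. *)

theory Defs
  imports "HOL-Analysis.Analysis" "HOL-Library.Function_Algebras"
begin

section \<open>Functions into a real vector space\<close>

instantiation "fun" :: (type, real_vector) real_vector
begin

definition scaleR_fun :: "real \<Rightarrow> ('a \<Rightarrow> 'b) \<Rightarrow> 'a \<Rightarrow> 'b" where
  "scaleR_fun c f = (\<lambda>x. c *\<^sub>R f x)"

instance
  by standard (auto simp: scaleR_fun_def scaleR_add_right scaleR_add_left)

end

lemma scaleR_fun_apply [simp]: "(c *\<^sub>R f) x = c *\<^sub>R f x"
  by (simp add: scaleR_fun_def)


section \<open>Finest locally convex topologies\<close>

text \<open>The topologies live on a linear subspace \<open>V\<close> of the ambient vector space. As in Bourbaki,
  a locally convex space is not required to be Hausdorff.\<close>

definition topological_vector_space_on :: "'v::real_vector set \<Rightarrow> 'v topology \<Rightarrow> bool" where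
  "topological_vector_space_on V T \<longleftrightarrow>
     subspace V \<and> topspace T = V \<and>
     continuous_map (prod_topology T T) T (\<lambda>(x, y). x + y) \<and>
     continuous_map (prod_topology euclideanreal T) T (\<lambda>(c, x). c *\<^sub>R x)"

definition locally_convex_on :: "'v::real_vector set \<Rightarrow> 'v topology \<Rightarrow> bool" where
  "locally_convex_on V T \<longleftrightarrow>
     topological_vector_space_on V T \<and> neighbourhood_base_at 0 convex T"

text \<open>The supremum of all locally convex topologies on \<open>V\<close> for which the inclusions of all members
  of the family \<open>\<S>\<close> (topologies on subsets of \<open>V\<close>) are continuous. By the lemma
  \<open>finest_locally_convex\<close> below it is itself such a topology, hence the finest one.\<close>

definition finest_locally_convex :: "'v::real_vector set \<Rightarrow> 'v topology set \<Rightarrow> 'v topology" where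
  "finest_locally_convex V \<S> =
     topology_generated_by
       {U. \<exists>T. locally_convex_on V T \<and> (\<forall>S\<in>\<S>. continuous_map S T id) \<and> openin T U}"

lemma openin_indiscreteD: "openin (topology_generated_by {V}) W \<Longrightarrow> W = {} \<or> W = V"
  by (drule openin_topology_generated_by, induct rule: generate_topology_on.induct) auto

lemma continuous_map_indiscrete:
  assumes "f \<in> topspace X \<rightarrow> V"
  shows "continuous_map X (topology_generated_by {V}) f"
  unfolding continuous_map
proof (intro conjI allI impI)
  show "f ` topspace X \<subseteq> topspace (topology_generated_by {V})" using assms by auto
  fix U assume "openin (topology_generated_by {V}) U"
  then have "U = {} \<or> U = V" by (rule openin_indiscreteD)
  moreover have "{x \<in> topspace X. f x \<in> V} = topspace X" using assms by auto
  ultimately show "openin X {x \<in> topspace X. f x \<in> U}" by auto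
qed

lemma locally_convex_on_indiscrete:
  assumes "subspace V"
  shows "locally_convex_on V (topology_generated_by {V})"
  unfolding locally_convex_on_def topological_vector_space_on_def
proof (intro conjI assms continuous_map_indiscrete)
  show "neighbourhood_base_at 0 convex (topology_generated_by {V})"
    unfolding neighbourhood_base_at_def
    using openin_indiscreteD subspace_imp_convex[OF assms] by (metis empty_iff order_refl)
qed (auto intro: subspace_add[OF assms] subspace_scale[OF assms])

lemma finest_locally_convex:
  fixes V :: "'v::real_vector set"
  assumes V: "subspace V" and sub: "\<And>S. S \<in> \<S> \<Longrightarrow> topspace S \<subseteq> V"
  shows "locally_convex_on V (finest_locally_convex V \<S>)"
    and "\<And>S. S \<in> \<S> \<Longrightarrow> continuous_map S (finest_locally_convex V \<S>) id"
    and "\<And>T U. \<lbrakk>locally_convex_on V T; \<And>S. S \<in> \<S> \<Longrightarrow> continuous_map S T id; openin T U\<rbrakk>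
           \<Longrightarrow> openin (finest_locally_convex V \<S>) U"
proof -
  define adm where "adm T \<longleftrightarrow> locally_convex_on V T \<and> (\<forall>S\<in>\<S>. continuous_map S T id)" for T
  define \<B> where "\<B> = {U. \<exists>T. adm T \<and> openin T U}"
  let ?F = "finest_locally_convex V \<S>"
  have F: "?F = topology_generated_by \<B>"
    unfolding finest_locally_convex_def \<B>_def adm_def by (simp add: conj_assoc)
  have ts: "topspace T = V" if "adm T" for T
    using that by (simp add: adm_def locally_convex_on_def topological_vector_space_on_def)
  have fine: "openin ?F U" if "adm T" "openin T U" for T U
    unfolding F using that by (intro topology_generated_by_Basis) (auto simp: \<B>_def)
  show "openin ?F U"
    if "locally_convex_on V T" "\<And>S. S \<in> \<S> \<Longrightarrow> continuous_map S T id" "openin T U" for T U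
    using that by (intro fine[of T]) (auto simp: adm_def)
  let ?I = "topology_generated_by {V}"
  have "continuous_map S ?I id" if "S \<in> \<S>" for S
    using sub[OF that] by (intro continuous_map_indiscrete) auto
  then have admI: "adm ?I"
    using locally_convex_on_indiscrete[OF V] by (simp add: adm_def)
  have UB: "\<Union>\<B> = V"
  proof
    show "\<Union>\<B> \<subseteq> V" using ts openin_subset unfolding \<B>_def by blast
    have "openin ?I V" by (rule topology_generated_by_Basis) simp
    then show "V \<subseteq> \<Union>\<B>" using admI unfolding \<B>_def by blast
  qed
  then have tF: "topspace ?F = V" by (simp add: F)
  show "continuous_map S ?F id" if "S \<in> \<S>" for S
    unfolding F
  proof (rule continuous_on_generated_topo)
    fix U assume "U \<in> \<B>"
    then obtain T where T: "adm T" "openin T U" unfolding \<B>_def by blast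
    then have "continuous_map S T id" using that by (simp add: adm_def)
    from openin_continuous_map_preimage[OF this T(2)]
    show "openin S (id -` U \<inter> topspace S)"
      by (simp add: vimage_def Int_def conj_commute)
  next
    show "id ` topspace S \<subseteq> \<Union>\<B>" using sub[OF that] UB by simp
  qed
  have id: "continuous_map ?F T id" if "adm T" for T
    unfolding continuous_map
  proof (intro conjI allI impI)
    show "id ` topspace ?F \<subseteq> topspace T" using ts[OF that] tF by simp
    fix U assume U: "openin T U"
    then have "U \<subseteq> V" using openin_subset ts[OF that] by metis
    then have "{x \<in> topspace ?F. id x \<in> U} = U" using tF by auto
    then show "openin ?F {x \<in> topspace ?F. id x \<in> U}" using fine[OF that U] by simp
  qed
  have add: "continuous_map (prod_topology ?F ?F) ?F (\<lambda>(x, y). x + y)"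
    unfolding F
  proof (rule continuous_on_generated_topo, unfold F[symmetric])
    fix U assume "U \<in> \<B>"
    then obtain T where T: "adm T" "openin T U" unfolding \<B>_def by blast
    have "continuous_map (prod_topology T T) T (\<lambda>(x, y). x + y)"
      using T by (simp add: adm_def locally_convex_on_def topological_vector_space_on_def)
    moreover have "continuous_map (prod_topology ?F ?F) (prod_topology T T) (\<lambda>(x, y). (id x, id y))"
      by (simp only: continuous_map_prod_top id[OF T(1)] simp_thms)
    ultimately have "continuous_map (prod_topology ?F ?F) T ((\<lambda>(x, y). x + y) \<circ> (\<lambda>(x, y). (id x, id y)))"
      by (rule continuous_map_compose[rotated])
    from openin_continuous_map_preimage[OF this T(2)]
    show "openin (prod_topology ?F ?F) ((\<lambda>(x, y). x + y) -` U \<inter> topspace (prod_topology ?F ?F))"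
      by (simp add: vimage_def Int_def conj_commute case_prod_unfold)
  next
    show "(\<lambda>(x, y). x + y) ` topspace (prod_topology ?F ?F) \<subseteq> \<Union>\<B>"
      using subspace_add[OF V] by (auto simp: tF UB)
  qed
  have scale: "continuous_map (prod_topology euclideanreal ?F) ?F (\<lambda>(c, x). c *\<^sub>R x)"
    unfolding F
  proof (rule continuous_on_generated_topo, unfold F[symmetric])
    fix U assume "U \<in> \<B>"
    then obtain T where T: "adm T" "openin T U" unfolding \<B>_def by blast
    have "continuous_map (prod_topology euclideanreal T) T (\<lambda>(c, x). c *\<^sub>R x)"
      using T by (simp add: adm_def locally_convex_on_def topological_vector_space_on_def)
    moreover have "continuous_map (prod_topology euclideanreal ?F) (prod_topology euclideanreal T)
        (\<lambda>(x, y). (id x, id y))"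
      by (simp only: continuous_map_prod_top id[OF T(1)] continuous_map_id simp_thms)
    ultimately have "continuous_map (prod_topology euclideanreal ?F) T
        ((\<lambda>(c, x). c *\<^sub>R x) \<circ> (\<lambda>(x, y). (id x, id y)))"
      by (rule continuous_map_compose[rotated])
    from openin_continuous_map_preimage[OF this T(2)]
    show "openin (prod_topology euclideanreal ?F)
        ((\<lambda>(c, x). c *\<^sub>R x) -` U \<inter> topspace (prod_topology euclideanreal ?F))"
      by (simp add: vimage_def Int_def conj_commute case_prod_unfold)
  next
    show "(\<lambda>(c, x). c *\<^sub>R x) ` topspace (prod_topology euclideanreal ?F) \<subseteq> \<Union>\<B>"
      using subspace_scale[OF V] by (auto simp: tF UB)
  qed
  have nb: "\<exists>A C. openin ?F A \<and> convex C \<and> 0 \<in> A \<and> A \<subseteq> C \<and> C \<subseteq> W"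
    if "generate_topology_on \<B> W" "0 \<in> W" for W
    using that
  proof induct
    case (Int a b)
    then obtain A C A' C' where
      "openin ?F A" "convex C" "0 \<in> A" "A \<subseteq> C" "C \<subseteq> a"
      "openin ?F A'" "convex C'" "0 \<in> A'" "A' \<subseteq> C'" "C' \<subseteq> b" by blast
    then have "openin ?F (A \<inter> A') \<and> convex (C \<inter> C') \<and> 0 \<in> A \<inter> A' \<and> A \<inter> A' \<subseteq> C \<inter> C' \<and> C \<inter> C' \<subseteq> a \<inter> b"
      by (auto intro: convex_Int)
    then show ?case by blast
  next
    case (UN K)
    then show ?case by (meson Union_iff Union_upper subset_trans)
  next
    case (Basis U)
    then obtain T where T: "adm T" "openin T U" unfolding \<B>_def by blast
    then have "neighbourhood_base_at 0 convex T" by (simp add: adm_def locally_convex_on_def)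
    then have "\<exists>A C. openin T A \<and> convex C \<and> 0 \<in> A \<and> A \<subseteq> C \<and> C \<subseteq> U"
      using T(2) Basis(2) by (simp add: neighbourhood_base_at_def)
    then obtain A C where "openin T A" "convex C" "0 \<in> A" "A \<subseteq> C" "C \<subseteq> U"
      by (elim exE conjE)
    with fine[OF T(1), of A] show ?case by (intro exI[of _ A] exI[of _ C]) simp
  qed simp
  then have "neighbourhood_base_at 0 convex ?F"
    unfolding neighbourhood_base_at_def
    using openin_topology_generated_by[of \<B>] by (simp add: F)
  with add scale tF V show "locally_convex_on V ?F"
    by (simp add: locally_convex_on_def topological_vector_space_on_def)
qed

text \<open>The topology induced on the subspace \<open>V\<close> by a norm \<open>N\<close> on \<open>V\<close>. The default value \<open>0\<close> is
  there because \<open>Metric_space\<close> asks for nonnegativity and symmetry on the whole type.\<close>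

definition norm_topology :: "'v::real_vector set \<Rightarrow> ('v \<Rightarrow> real) \<Rightarrow> 'v topology" where
  "norm_topology V N = Metric_space.mtopology V (\<lambda>x y. if x \<in> V \<and> y \<in> V then N (x - y) else 0)"


section \<open>Continuous functions with compact support\<close>

definition spt :: "('x::topological_space \<Rightarrow> 'z::real_normed_vector) \<Rightarrow> 'x set" where
  "spt f = closure (support_on UNIV f)"

definition sup_norm :: "('x \<Rightarrow> 'z::real_normed_vector) \<Rightarrow> real" where
  "sup_norm f = (SUP x. norm (f x))"

definition K_on :: "'x::t2_space set \<Rightarrow> ('x \<Rightarrow> 'z::real_normed_vector) set" where
  "K_on K = {f. continuous_on UNIV f \<and> spt f \<subseteq> K}"

definition K_space :: "('x::t2_space \<Rightarrow> 'z::real_normed_vector) set" where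
  "K_space = (\<Union>K\<in>Collect compact. K_on K)"

definition K_topology :: "('x::t2_space \<Rightarrow> 'z::real_normed_vector) topology" where
  "K_topology =
     finest_locally_convex K_space ((\<lambda>K. norm_topology (K_on K) sup_norm) ` Collect compact)"


section \<open>Continuously differentiable functions whose derivative has compact support\<close>

text \<open>The derivative as an element of the normed space of bounded linear functionals; meaningful
  where \<open>\<gamma>\<close> is (Frechet) differentiable.\<close>

definition Diff :: "('a::real_normed_vector \<Rightarrow> real) \<Rightarrow> 'a \<Rightarrow> 'a \<Rightarrow>\<^sub>L real" where
  "Diff \<gamma> y = Blinfun (frechet_derivative \<gamma> (at y))"

definition E_on :: "real \<Rightarrow> ('a::real_normed_vector \<Rightarrow> real) set" where
  "E_on s = {\<gamma>. (\<forall>y. \<gamma> differentiable (at y)) \<and> continuous_on UNIV (Diff \<gamma>) \<and>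
                 \<gamma> 0 = 0 \<and> spt (Diff \<gamma>) \<subseteq> cball 0 s}"

definition E_space :: "('a::real_normed_vector \<Rightarrow> real) set" where
  "E_space = (\<Union>s\<in>{0..}. E_on s)"

definition E_topology :: "('a::real_normed_vector \<Rightarrow> real) topology" where
  "E_topology =
     finest_locally_convex E_space
       ((\<lambda>s. norm_topology (E_on s) (\<lambda>\<gamma>. sup_norm (Diff \<gamma>))) ` {0..})"

text \<open>Only the values of \<open>\<alpha>\<close> at positive integers matter.\<close>

definition W_set :: "(nat \<Rightarrow> nat) \<Rightarrow> ('a::real_normed_vector \<Rightarrow> real) set" where
  "W_set \<alpha> = {\<gamma> \<in> E_space. \<forall>i\<ge>1. \<forall>y. norm y > real i - 1 \<longrightarrow>
                              norm (Diff \<gamma> y) \<le> inverse (real (\<alpha> i))}"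


section \<open>Neighbourhoods\<close>

definition neighbourhood_of :: "'v topology \<Rightarrow> 'v \<Rightarrow> 'v set \<Rightarrow> bool" where
  "neighbourhood_of T x N \<longleftrightarrow> N \<subseteq> topspace T \<and> (\<exists>U. openin T U \<and> x \<in> U \<and> U \<subseteq> N)"

definition fundamental_system_of_neighbourhoods :: "'v topology \<Rightarrow> 'v \<Rightarrow> 'v set set \<Rightarrow> bool" where
  "fundamental_system_of_neighbourhoods T x \<N> \<longleftrightarrow>
     (\<forall>N\<in>\<N>. neighbourhood_of T x N) \<and> (\<forall>M. neighbourhood_of T x M \<longrightarrow> (\<exists>N\<in>\<N>. N \<subseteq> M))"


section \<open>Well-definedness\<close>

text \<open>The constants \<^const>\<open>norm_topology\<close> and \<^const>\<open>finest_locally_convex\<close> have the intended meaning only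
  for norms and for families of topologies on subsets of a linear subspace. For \<^const>\<open>E_on\<close>,
  the closed balls are assumed to be compact, as they are in every finite-dimensional space.\<close>

definition norm_on :: "'v::real_vector set \<Rightarrow> ('v \<Rightarrow> real) \<Rightarrow> bool" where
  "norm_on V N \<longleftrightarrow> subspace V \<and>
     (\<forall>x\<in>V. 0 \<le> N x \<and> (N x = 0 \<longrightarrow> x = 0)) \<and>
     (\<forall>x\<in>V. \<forall>c. N (c *\<^sub>R x) = \<bar>c\<bar> * N x) \<and>
     (\<forall>x\<in>V. \<forall>y\<in>V. N (x + y) \<le> N x + N y)"

lemma norm_on_Metric_space:
  assumes "norm_on V N"
  shows "Metric_space V (\<lambda>x y. if x \<in> V \<and> y \<in> V then N (x - y) else 0)"
proof
  have V: "subspace V" using assms by (simp add: norm_on_def)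
  note diff = subspace_diff[OF V]
  have scale: "N (c *\<^sub>R x) = \<bar>c\<bar> * N x" if "x \<in> V" for c x
    using assms that by (simp add: norm_on_def)
  have tri: "N (x + y) \<le> N x + N y" if "x \<in> V" "y \<in> V" for x y
    using assms that by (simp add: norm_on_def)
  show "0 \<le> (if x \<in> V \<and> y \<in> V then N (x - y) else 0)" for x y
    using assms diff by (simp add: norm_on_def)
  have "N (x - y) = N (y - x)" if "x \<in> V" "y \<in> V" for x y
    using scale[OF diff[OF that], of "-1"] by simp
  then show "(if x \<in> V \<and> y \<in> V then N (x - y) else 0) = (if y \<in> V \<and> x \<in> V then N (y - x) else 0)"
    for x y by simp
  have "N 0 = 0" using scale[OF subspace_0[OF V], of 0] by simp
  then show "((if x \<in> V \<and> y \<in> V then N (x - y) else 0) = 0) = (x = y)" if "x \<in> V" "y \<in> V" for x y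
    using that assms diff[of x y] by (auto simp: norm_on_def)
  show "(if x \<in> V \<and> z \<in> V then N (x - z) else 0)
      \<le> (if x \<in> V \<and> y \<in> V then N (x - y) else 0) + (if y \<in> V \<and> z \<in> V then N (y - z) else 0)"
    if "x \<in> V" "y \<in> V" "z \<in> V" for x y z
    using tri[OF diff[OF that(1,2)] diff[OF that(2,3)]] that by simp
qed

lemma topspace_norm_topology: "norm_on V N \<Longrightarrow> topspace (norm_topology V N) = V"
  unfolding norm_topology_def by (intro Metric_space.topspace_mtopology norm_on_Metric_space)

lemma spt_add: "spt (\<lambda>x. f x + g x) \<subseteq> spt f \<union> spt g"
  unfolding spt_def closure_Un[symmetric]
  by (intro closure_mono) (auto simp: support_on_def)

lemma spt_scaleR: "spt (\<lambda>x. c *\<^sub>R f x) \<subseteq> spt f"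
  unfolding spt_def by (intro closure_mono) (auto simp: support_on_def)

lemma spt_zero: "spt (\<lambda>x. 0) = {}"
  by (simp add: spt_def support_on_def)

lemma bdd_above_K_on:
  assumes "f \<in> K_on K" "compact K"
  shows "bdd_above (range (\<lambda>x. norm (f x)))"
proof -
  have "compact (f ` K)"
    using assms by (auto simp: K_on_def intro: compact_continuous_image continuous_on_subset)
  then obtain B where B: "\<And>x. x \<in> K \<Longrightarrow> norm (f x) \<le> B"
    by (meson compact_imp_bounded bounded_iff image_eqI)
  have "f x = 0" if "x \<notin> K" for x
    using assms(1) that closure_subset[of "support_on UNIV f"]
    by (auto simp: K_on_def spt_def support_on_def)
  then have "norm (f x) \<le> max B 0" for x
    using B[of x] by (cases "x \<in> K") auto
  then show ?thesis by (meson bdd_aboveI2)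
qed

lemma subspace_K_on: "subspace (K_on K)"
  unfolding subspace_def
proof (intro conjI allI ballI)
  show "0 \<in> K_on K" by (simp add: K_on_def zero_fun_def spt_zero)
  show "f + g \<in> K_on K" if "f \<in> K_on K" "g \<in> K_on K" for f g
    using that spt_add[of f g] by (auto simp: K_on_def plus_fun_def intro: continuous_on_add)
  show "c *\<^sub>R f \<in> K_on K" if "f \<in> K_on K" for c f
    using that spt_scaleR[of c f] by (auto simp: K_on_def scaleR_fun_def intro: continuous_on_scaleR)
qed

lemma sup_norm_facts:
  assumes "bdd_above (range (\<lambda>x. norm (f x)))"
  shows "0 \<le> sup_norm f" and "sup_norm f = 0 \<Longrightarrow> f = 0"
    and "sup_norm (\<lambda>x. c *\<^sub>R f x) = \<bar>c\<bar> * sup_norm f"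
    and "bdd_above (range (\<lambda>x. norm (g x))) \<Longrightarrow> sup_norm (\<lambda>x. f x + g x) \<le> sup_norm f + sup_norm g"
proof -
  have le: "norm (f x) \<le> sup_norm f" for x
    unfolding sup_norm_def by (rule cSUP_upper[OF UNIV_I assms])
  show "0 \<le> sup_norm f" using le norm_ge_zero order_trans by blast
  show "f = 0" if "sup_norm f = 0"
    using le that by (auto simp: fun_eq_iff)
  show "sup_norm (\<lambda>x. f x + g x) \<le> sup_norm f + sup_norm g"
    if g: "bdd_above (range (\<lambda>x. norm (g x)))"
  proof -
    have "norm (g x) \<le> sup_norm g" for x
      unfolding sup_norm_def by (rule cSUP_upper[OF UNIV_I g])
    then show ?thesis
      unfolding sup_norm_def[of "\<lambda>x. f x + g x"]
      using le by (intro cSUP_least) (auto intro: norm_triangle_mono)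
  qed
  show "sup_norm (\<lambda>x. c *\<^sub>R f x) = \<bar>c\<bar> * sup_norm f"
  proof (cases "c = 0")
    case False
    have bd: "bdd_above (range (\<lambda>x. norm (c *\<^sub>R f x)))"
      using le by (intro bdd_aboveI2[of _ _ "\<bar>c\<bar> * sup_norm f"]) (simp add: mult_left_mono)
    have "norm (f x) \<le> sup_norm (\<lambda>x. c *\<^sub>R f x) / \<bar>c\<bar>" for x
      using cSUP_upper[OF UNIV_I bd, of x] False
      by (simp add: sup_norm_def field_simps)
    then have "sup_norm f \<le> sup_norm (\<lambda>x. c *\<^sub>R f x) / \<bar>c\<bar>"
      unfolding sup_norm_def[of f] by (intro cSUP_least) auto
    then have "\<bar>c\<bar> * sup_norm f \<le> sup_norm (\<lambda>x. c *\<^sub>R f x)"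
      using False by (simp add: field_simps)
    moreover have "sup_norm (\<lambda>x. c *\<^sub>R f x) \<le> \<bar>c\<bar> * sup_norm f"
      unfolding sup_norm_def[of "\<lambda>x. c *\<^sub>R f x"] using le
      by (intro cSUP_least) (auto simp: mult_left_mono)
    ultimately show ?thesis by simp
  qed (simp add: sup_norm_def)
qed

lemma norm_on_K_on:
  assumes "compact K"
  shows "norm_on (K_on K) (sup_norm :: ('x::t2_space \<Rightarrow> 'z::real_normed_vector) \<Rightarrow> real)"
  unfolding norm_on_def
proof (intro conjI allI ballI subspace_K_on impI)
  note bdd = bdd_above_K_on[OF _ assms]
  fix f :: "'x \<Rightarrow> 'z" assume f: "f \<in> K_on K"
  show "0 \<le> sup_norm f" by (rule sup_norm_facts(1)[OF bdd[OF f]])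
  show "f = 0" if "sup_norm f = 0" by (rule sup_norm_facts(2)[OF bdd[OF f] that])
  show "sup_norm (c *\<^sub>R f) = \<bar>c\<bar> * sup_norm f" for c
    using sup_norm_facts(3)[OF bdd[OF f]] by (simp add: scaleR_fun_def)
  show "sup_norm (f + g) \<le> sup_norm f + sup_norm g" if "g \<in> K_on K" for g
    using sup_norm_facts(4)[OF bdd[OF f] bdd[OF that]] by (simp add: plus_fun_def)
qed

lemma subspace_directed_UN:
  assumes "I \<noteq> {}" "\<And>i. i \<in> I \<Longrightarrow> subspace (A i)"
    and "\<And>i j. \<lbrakk>i \<in> I; j \<in> I\<rbrakk> \<Longrightarrow> \<exists>k\<in>I. A i \<union> A j \<subseteq> A k"
  shows "subspace (\<Union>i\<in>I. A i)"
  unfolding subspace_def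
proof (intro conjI allI ballI)
  show "0 \<in> (\<Union>i\<in>I. A i)" using assms(1,2) subspace_0 by blast
  show "c *\<^sub>R x \<in> (\<Union>i\<in>I. A i)" if "x \<in> (\<Union>i\<in>I. A i)" for c x
    using that assms(2) subspace_scale by blast
  fix x y assume "x \<in> (\<Union>i\<in>I. A i)" "y \<in> (\<Union>i\<in>I. A i)"
  then obtain i j where ij: "i \<in> I" "j \<in> I" "x \<in> A i" "y \<in> A j" by blast
  then obtain k where "k \<in> I" "x \<in> A k" "y \<in> A k" using assms(3)[of i j] by blast
  then show "x + y \<in> (\<Union>i\<in>I. A i)" using assms(2) subspace_add by blast
qed

lemma subspace_K_space: "subspace K_space"
  unfolding K_space_def
proof (rule subspace_directed_UN)
  show "Collect compact \<noteq> ({} :: 'a set set)" using compact_empty by blast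
  show "\<exists>k\<in>Collect compact. K_on i \<union> K_on j \<subseteq> (K_on k :: ('a \<Rightarrow> 'b) set)"
    if "i \<in> Collect compact" "j \<in> Collect compact" for i j
    using that by (intro bexI[of _ "i \<union> j"]) (auto simp: K_on_def)
qed (rule subspace_K_on)

lemma has_derivative_Diff:
  assumes "\<gamma> differentiable (at y)"
  shows "(\<gamma> has_derivative blinfun_apply (Diff \<gamma> y)) (at y)"
  using assms unfolding Diff_def
  by (simp add: bounded_linear_Blinfun_apply frechet_derivative_works has_derivative_bounded_linear)

lemma Diff_eq:
  assumes "(\<gamma> has_derivative blinfun_apply L) (at y)"
  shows "Diff \<gamma> y = L"
  using frechet_derivative_at[OF assms, symmetric] by (simp add: Diff_def blinfun_apply_inverse)

lemma Diff_linear: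
  assumes "\<And>y. \<gamma> differentiable (at y)" "\<And>y. \<delta> differentiable (at y)"
  shows "Diff (\<gamma> + \<delta>) = (\<lambda>y. Diff \<gamma> y + Diff \<delta> y)" and "Diff (c *\<^sub>R \<gamma>) = (\<lambda>y. c *\<^sub>R Diff \<gamma> y)"
proof -
  note d = has_derivative_Diff[OF assms(1)] has_derivative_Diff[OF assms(2)]
  show "Diff (\<gamma> + \<delta>) = (\<lambda>y. Diff \<gamma> y + Diff \<delta> y)"
    using has_derivative_add[OF d]
    by (intro ext Diff_eq) (simp add: plus_fun_def plus_blinfun.rep_eq)
  show "Diff (c *\<^sub>R \<gamma>) = (\<lambda>y. c *\<^sub>R Diff \<gamma> y)"
    using has_derivative_scaleR_right[OF d(1)]
    by (intro ext Diff_eq) (simp add: scaleR_fun_def scaleR_blinfun.rep_eq)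
qed

lemma Diff_zero: "Diff 0 = (\<lambda>y. 0)"
  by (intro ext Diff_eq) (simp add: zero_fun_def zero_blinfun.rep_eq)

lemma Diff_E_on: "\<gamma> \<in> E_on s \<Longrightarrow> Diff \<gamma> \<in> K_on (cball 0 s)"
  by (simp add: E_on_def K_on_def)

lemma subspace_E_on: "subspace (E_on s :: ('a::real_normed_vector \<Rightarrow> real) set)"
  unfolding subspace_def
proof (intro conjI allI ballI)
  show "0 \<in> E_on s" by (simp add: E_on_def Diff_zero spt_zero) (simp add: zero_fun_def)
  show "\<gamma> + \<delta> \<in> E_on s" if "\<gamma> \<in> E_on s" "\<delta> \<in> E_on s" for \<gamma> \<delta> :: "'a \<Rightarrow> real"
    using that spt_add[of "Diff \<gamma>" "Diff \<delta>"] Diff_linear(1)[of \<gamma> \<delta>]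
    by (auto simp: E_on_def plus_fun_def intro: continuous_on_add)
  show "c *\<^sub>R \<gamma> \<in> E_on s" if "\<gamma> \<in> E_on s" for c and \<gamma> :: "'a \<Rightarrow> real"
    using that spt_scaleR[of c "Diff \<gamma>"] Diff_linear(2)[of \<gamma> \<gamma> c]
    by (auto simp: E_on_def scaleR_fun_def intro: continuous_on_scaleR)
qed

lemma norm_on_E_on:
  assumes "compact (cball (0::'a::real_normed_vector) s)"
  shows "norm_on (E_on s :: ('a \<Rightarrow> real) set) (\<lambda>\<gamma>. sup_norm (Diff \<gamma>))"
  unfolding norm_on_def
proof (intro conjI allI ballI subspace_E_on impI)
  note bdd = bdd_above_K_on[OF Diff_E_on assms]
  fix \<gamma> :: "'a \<Rightarrow> real" assume \<gamma>: "\<gamma> \<in> E_on s"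
  show "0 \<le> sup_norm (Diff \<gamma>)" by (rule sup_norm_facts(1)[OF bdd[OF \<gamma>]])
  show "sup_norm (Diff (c *\<^sub>R \<gamma>)) = \<bar>c\<bar> * sup_norm (Diff \<gamma>)" for c
    using sup_norm_facts(3)[OF bdd[OF \<gamma>]] Diff_linear(2)[of \<gamma> \<gamma> c] \<gamma> by (simp add: E_on_def)
  show "sup_norm (Diff (\<gamma> + \<delta>)) \<le> sup_norm (Diff \<gamma>) + sup_norm (Diff \<delta>)" if "\<delta> \<in> E_on s" for \<delta>
    using sup_norm_facts(4)[OF bdd[OF \<gamma>] bdd[OF that]] Diff_linear(1)[of \<gamma> \<delta>] \<gamma> that
    by (simp add: E_on_def)
  assume "sup_norm (Diff \<gamma>) = 0"
  then have "Diff \<gamma> = 0" by (rule sup_norm_facts(2)[OF bdd[OF \<gamma>]])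
  then have "(\<gamma> has_derivative (\<lambda>h. 0)) (at y)" for y
    using has_derivative_Diff[of \<gamma> y] \<gamma> by (simp add: E_on_def zero_blinfun.rep_eq)
  then obtain c where "\<And>y. \<gamma> y = c"
    using has_derivative_zero_constant[of UNIV \<gamma>] by auto
  then show "\<gamma> = 0" using \<gamma> by (auto simp: E_on_def fun_eq_iff)
qed

lemma subspace_E_space: "subspace E_space"
  unfolding E_space_def
proof (rule subspace_directed_UN)
  show "{0..} \<noteq> ({} :: real set)" by auto
  show "\<exists>k\<in>{0..}. E_on i \<union> E_on j \<subseteq> (E_on k :: ('a \<Rightarrow> real) set)"
    if "i \<in> {0..}" "j \<in> {0..}" for i j :: real
    using that by (intro bexI[of _ "max i j"]) (auto simp: E_on_def)
qed (rule subspace_E_on)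

end

theory Submission
  imports Defs
begin

text \<open>
  Both halves rest on the sets \<open>W\<^sub>\<alpha>\<close>. If \<open>w\<close> is a locally bounded positive weight with \<open>w y \<ge> \<alpha> i\<close>
  whenever \<open>|y| > i - 1\<close>, then the weighted supremum norm \<open>sup w |f|\<close> is a continuous norm
  on the space of continuous functions with compact support, and the preimage under \<open>D\<close> of its unit
  ball lies in \<open>W\<^sub>\<alpha>\<close>. As \<open>D\<close> is continuous, \<open>W\<^sub>\<alpha>\<close> is a neighbourhood of \<open>0\<close>; and \<open>D\<close> is an
  embedding as soon as every neighbourhood of \<open>0\<close> contains some \<open>W\<^sub>\<alpha>\<close>.

  For the latter, take a \<open>C\<^sup>1\<close> partition of unity \<open>\<theta>\<^sub>i\<close> with \<open>\<theta>\<^sub>i\<close> supported in a shell outside the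
  ball of radius \<open>i\<close>. The form \<open>\<theta>\<^sub>i D\<gamma>\<close> need not be a derivative, but for large \<open>T\<close> the function
  \<open>P\<^sub>i y = \<theta>\<^sub>i y * (\<gamma> y - \<gamma> (T y))\<close> (with a correction at \<open>i = 0\<close>) satisfies
  \<open>DP\<^sub>i y = \<theta>\<^sub>i y D\<gamma> y + (\<gamma> y - \<gamma> (T y)) D\<theta>\<^sub>i y\<close>, and \<open>\<gamma> = \<Sum>\<^sub>i P\<^sub>i\<close>. If \<open>\<alpha>\<close> grows so fast that
  \<open>|D\<gamma> z| \<le> \<eta>\<^sub>i / |z|\<^sup>2\<close> for \<open>|z| \<ge> i\<close>, integration along rays gives \<open>|\<gamma> y - \<gamma> (T y)| \<le> \<eta>\<^sub>i / |y|\<close>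
  there, so all \<open>DP\<^sub>i\<close> are as small as desired and convexity puts \<open>\<gamma>\<close> into the given neighbourhood.
\<close>

section \<open>Finite-dimensional normed spaces\<close>

text \<open>Induction on \<open>B\<close>: adjoining \<open>a\<close> turns the box into the
  Minkowski sum of a compact segment and the previous box.\<close>

lemma compact_coordinate_box:
  fixes B :: "'a::real_normed_vector set"
  assumes "finite B"
  shows "compact {\<Sum>b\<in>B. x b *\<^sub>R b | x. \<forall>b\<in>B. \<bar>x b\<bar> \<le> r}"
  using assms
proof (induction B)
  case empty
  then show ?case by simp
next
  case (insert a B)
  let ?K = "{\<Sum>b\<in>B. x b *\<^sub>R b | x. \<forall>b\<in>B. \<bar>x b\<bar> \<le> r}"
  have "{\<Sum>b\<in>insert a B. x b *\<^sub>R b | x. \<forall>b\<in>insert a B. \<bar>x b\<bar> \<le> r}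
      = {u + v | u v. u \<in> (\<lambda>t. t *\<^sub>R a) ` {-r..r} \<and> v \<in> ?K}" (is "?L = ?R")
  proof
    show "?L \<subseteq> ?R"
    proof
      fix z assume "z \<in> ?L"
      then obtain x where x: "\<forall>b\<in>insert a B. \<bar>x b\<bar> \<le> r"
        and z: "z = x a *\<^sub>R a + (\<Sum>b\<in>B. x b *\<^sub>R b)"
        using insert.hyps by auto
      have "x a *\<^sub>R a \<in> (\<lambda>t. t *\<^sub>R a) ` {-r..r}"
        using x by (intro imageI) (simp add: abs_le_iff)
      moreover have "(\<Sum>b\<in>B. x b *\<^sub>R b) \<in> ?K" using x by auto
      ultimately show "z \<in> ?R" using z by blast
    qed
    show "?R \<subseteq> ?L"
    proof
      fix z assume "z \<in> ?R"
      then obtain t x where t: "\<bar>t\<bar> \<le> r" and x: "\<forall>b\<in>B. \<bar>x b\<bar> \<le> r"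
        and z: "z = t *\<^sub>R a + (\<Sum>b\<in>B. x b *\<^sub>R b)"
        by (force simp: abs_le_iff)
      have "(\<Sum>b\<in>B. (x(a := t)) b *\<^sub>R b) = (\<Sum>b\<in>B. x b *\<^sub>R b)"
        using insert.hyps by (intro sum.cong) auto
      then have "z = (\<Sum>b\<in>insert a B. (x(a := t)) b *\<^sub>R b)"
        using insert.hyps z by simp
      moreover have "\<forall>b\<in>insert a B. \<bar>(x(a := t)) b\<bar> \<le> r" using t x by simp
      ultimately show "z \<in> ?L" by blast
    qed
  qed
  moreover have "compact ((\<lambda>t. t *\<^sub>R a) ` {-r..r})"
    by (intro compact_continuous_image continuous_intros) auto
  ultimately show ?case using insert.IH by (simp only: compact_sums)
qed

text \<open>Induction on \<open>B\<close>: as \<open>a\<close> lies outside \<open>span B\<close>,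
  its distance from that span is at least some \<open>d > 0\<close>. This bounds the coefficient of
  \<open>a\<close>; after subtracting \<open>x a *\<^sub>R a\<close>, the induction hypothesis
  bounds the other ones.\<close>

lemma coordinates_bounded:
  fixes B :: "'a::real_normed_vector set"
  assumes "finite B" "independent B"
  shows "\<exists>C>0. \<forall>x. (\<Sum>b\<in>B. \<bar>x b\<bar>) \<le> C * norm (\<Sum>b\<in>B. x b *\<^sub>R b)"
  using assms
proof (induction B)
  case empty
  then show ?case by (auto intro: exI[of _ 1])
next
  case (insert a B)
  then have "independent B" and a: "a \<notin> span B"
    by (simp_all add: independent_insert)
  with insert.IH obtain C where C: "C > 0"
    and bound: "\<And>x. (\<Sum>b\<in>B. \<bar>x b\<bar>) \<le> C * norm (\<Sum>b\<in>B. x b *\<^sub>R b)" by blast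
  let ?K = "{\<Sum>b\<in>B. x b *\<^sub>R b | x. \<forall>b\<in>B. \<bar>x b\<bar> \<le> C * (norm a + 1)}"
  have "?K \<subseteq> span B" by (auto intro: span_sum span_scale span_base)
  then have "a \<notin> ?K" using a by blast
  moreover have "open (- ?K)"
    using compact_imp_closed[OF compact_coordinate_box[OF insert.hyps(1)]] by (rule open_Compl)
  ultimately obtain e where e: "e > 0" "ball a e \<subseteq> - ?K"
    using openE[of "- ?K" a] by blast
  define d where "d = min e 1"
  have d: "d > 0" using e by (simp add: d_def)
  \<comment> \<open>A combination of norm at most \<open>norm a + 1\<close> has coefficients bounded
    by the induction hypothesis, so its negative lies in the box \<open>?K\<close>, which misses
    \<open>ball a e\<close>. A larger combination is at distance at least 1 from
    \<open>- a\<close>.\<close>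
  have dist: "d \<le> norm (a + (\<Sum>b\<in>B. x b *\<^sub>R b))" for x
  proof (cases "norm (\<Sum>b\<in>B. x b *\<^sub>R b) \<le> norm a + 1")
    case True
    have "\<bar>x b\<bar> \<le> C * (norm a + 1)" if "b \<in> B" for b
    proof -
      have "\<bar>x b\<bar> \<le> (\<Sum>b\<in>B. \<bar>x b\<bar>)" using that insert.hyps(1) by (intro member_le_sum) auto
      also have "\<dots> \<le> C * (norm a + 1)"
        using bound[of x] True C by (smt (verit) mult_left_mono)
      finally show ?thesis .
    qed
    then have "(\<Sum>b\<in>B. (- x b) *\<^sub>R b) \<in> ?K" by (intro CollectI exI[of _ "\<lambda>b. - x b"]) auto
    then have "(\<Sum>b\<in>B. (- x b) *\<^sub>R b) \<notin> ball a e" using e(2) by blast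
    then show ?thesis by (simp add: d_def dist_norm sum_negf)
  next
    case False
    then have "1 \<le> norm (a + (\<Sum>b\<in>B. x b *\<^sub>R b))"
      using norm_diff_ineq[of "\<Sum>b\<in>B. x b *\<^sub>R b" a] by (simp add: add.commute)
    then show ?thesis by (simp add: d_def)
  qed
  have "(\<Sum>b\<in>insert a B. \<bar>x b\<bar>)
      \<le> (1 / d + C + C * norm a / d) * norm (\<Sum>b\<in>insert a B. x b *\<^sub>R b)" for x
  proof -
    let ?v = "\<Sum>b\<in>B. x b *\<^sub>R b"
    let ?z = "x a *\<^sub>R a + ?v"
    \<comment> \<open>Normalising the coefficient of \<open>a\<close> to 1 makes \<open>dist\<close>
      applicable.\<close>
    have xa: "\<bar>x a\<bar> \<le> norm ?z / d"
    proof (cases "x a = 0")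
      case False
      have "\<bar>x a\<bar> * d \<le> \<bar>x a\<bar> * norm (a + (\<Sum>b\<in>B. (x b / x a) *\<^sub>R b))"
        using dist by (intro mult_left_mono) auto
      also have "\<dots> = norm (x a *\<^sub>R (a + (\<Sum>b\<in>B. (x b / x a) *\<^sub>R b)))" by simp
      also have "x a *\<^sub>R (a + (\<Sum>b\<in>B. (x b / x a) *\<^sub>R b)) = ?z"
        using False by (simp add: scaleR_add_right scaleR_sum_right)
      finally show ?thesis using d by (simp add: field_simps)
    qed (use d in simp)
    have "norm ?v \<le> norm ?z + norm (x a *\<^sub>R a)"
      using norm_triangle_ineq4[of ?z "x a *\<^sub>R a"] by simp
    also have "\<dots> \<le> norm ?z + norm ?z / d * norm a"
      using mult_right_mono[OF xa norm_ge_zero[of a]] by simp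
    finally have "C * norm ?v \<le> C * (norm ?z + norm ?z / d * norm a)"
      using C by (intro mult_left_mono) auto
    then have "\<bar>x a\<bar> + (\<Sum>b\<in>B. \<bar>x b\<bar>) \<le> norm ?z / d + C * (norm ?z + norm ?z / d * norm a)"
      using bound[of x] xa by linarith
    also have "\<dots> = (1 / d + C + C * norm a / d) * norm ?z" by (simp add: algebra_simps)
    finally show ?thesis using insert.hyps by simp
  qed
  moreover have "1 / d + C + C * norm a / d > 0"
    using C d by (intro add_pos_nonneg add_pos_pos) auto
  ultimately show ?case by blast
qed

text \<open>A basis is extracted from the spanning set; the bound on the sum of the coordinates
  makes each of them a bounded linear functional.\<close>

lemma finite_dimensional_coordinates:
  assumes "\<exists>B :: 'a::real_normed_vector set. finite B \<and> span B = UNIV"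
  obtains B :: "'a::real_normed_vector set" and C r where "finite B" "C > 0"
    "\<And>y. (\<Sum>b\<in>B. r b y *\<^sub>R b) = y" "\<And>y. (\<Sum>b\<in>B. \<bar>r b y\<bar>) \<le> C * norm y"
    "\<And>b. b \<in> B \<Longrightarrow> bounded_linear (r b)"
proof -
  obtain B0 :: "'a set" where B0: "finite B0" "span B0 = UNIV" using assms by blast
  obtain B where B: "B \<subseteq> B0" "independent B" "B0 \<subseteq> span B"
    using maximal_independent_subset[of B0] by blast
  have span: "span B = UNIV" using B0(2) B(3) span_mono[OF B(3)] by (simp add: span_span) blast
  have fin: "finite B" using B(1) B0(1) finite_subset by blast
  define r where "r b y = representation B y b" for b y
  obtain C where C: "C > 0" "\<And>x. (\<Sum>b\<in>B. \<bar>x b\<bar>) \<le> C * norm (\<Sum>b\<in>B. x b *\<^sub>R b)"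
    using coordinates_bounded[OF fin B(2)] by blast
  have rep: "(\<Sum>b\<in>B. r b y *\<^sub>R b) = y" for y
    unfolding r_def by (rule sum_representation_eq[OF B(2) _ fin order_refl]) (simp add: span)
  have bd: "(\<Sum>b\<in>B. \<bar>r b y\<bar>) \<le> C * norm y" for y
    using C(2)[of "\<lambda>b. r b y"] rep[of y] by simp
  have "bounded_linear (r b)" if "b \<in> B" for b
  proof (rule bounded_linear_intro[where K = C])
    show "r b (x + y) = r b x + r b y" for x y
      unfolding r_def using representation_add[OF B(2), of y x] by (simp add: span)
    show "r b (c *\<^sub>R x) = c *\<^sub>R r b x" for c x
      unfolding r_def using representation_scale[OF B(2), of x c] by (simp add: span)
    have "\<bar>r b y\<bar> \<le> (\<Sum>b\<in>B. \<bar>r b y\<bar>)" for y using that fin by (intro member_le_sum) auto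
    then show "norm (r b y) \<le> norm y * C" for y
      using order_trans[OF _ bd, of "\<bar>r b y\<bar>" y] by (simp add: mult.commute)
  qed
  with fin C(1) rep bd show ?thesis by (rule that)
qed

text \<open>The ball is a closed subset of a compact coordinate box.\<close>

lemma compact_cball_finite_dimensional:
  assumes "\<exists>B :: 'a::real_normed_vector set. finite B \<and> span B = UNIV"
  shows "compact (cball (0::'a) s)"
proof -
  obtain B :: "'a set" and C r where B: "finite B" "C > 0"
    "\<And>y. (\<Sum>b\<in>B. r b y *\<^sub>R b) = y" "\<And>y. (\<Sum>b\<in>B. \<bar>r b y\<bar>) \<le> C * norm y"
    "\<And>b. b \<in> B \<Longrightarrow> bounded_linear (r b)"
    using finite_dimensional_coordinates[OF assms] by blast
  let ?K = "{\<Sum>b\<in>B. x b *\<^sub>R b | x. \<forall>b\<in>B. \<bar>x b\<bar> \<le> C * s}"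
  have "cball 0 s \<subseteq> ?K"
  proof
    fix y :: 'a assume y: "y \<in> cball 0 s"
    have "\<bar>r b y\<bar> \<le> C * s" if "b \<in> B" for b
    proof -
      have "\<bar>r b y\<bar> \<le> (\<Sum>b\<in>B. \<bar>r b y\<bar>)" using that B(1) by (intro member_le_sum) auto
      also have "\<dots> \<le> C * s" using B(4)[of y] B(2) y by (smt (verit) mem_cball_0 mult_left_mono)
      finally show ?thesis .
    qed
    then show "y \<in> ?K" using B(3)[of y] by (intro CollectI exI[of _ "\<lambda>b. r b y"]) simp
  qed
  then have "cball 0 s \<inter> ?K = cball 0 s" by blast
  then show ?thesis
    using closed_Int_compact[OF closed_cball[of 0 s] compact_coordinate_box[OF B(1), of "C * s"]]
    by simp
qed

text \<open>A differentiable stand-in for the squared norm, which itself may fail to be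
  differentiable: the sum of the squared coordinates. Dividing by \<open>C\<^sup>2\<close> gives the
  upper bound, and Cauchy-Schwarz applied to the expansion of \<open>y\<close> gives the lower
  one.\<close>

lemma finite_dimensional_quadratic:
  assumes "\<exists>B :: 'a::real_normed_vector set. finite B \<and> span B = UNIV"
  obtains q :: "'a::real_normed_vector \<Rightarrow> real" and D c where "c > 0"
    "\<And>y. (q has_derivative blinfun_apply (D y)) (at y)" "continuous_on UNIV D"
    "\<And>y. q y \<le> (norm y)\<^sup>2" "\<And>y. c * (norm y)\<^sup>2 \<le> q y"
proof -
  obtain B :: "'a set" and C r where B: "finite B" "C > 0"
    "\<And>y. (\<Sum>b\<in>B. r b y *\<^sub>R b) = y" "\<And>y. (\<Sum>b\<in>B. \<bar>r b y\<bar>) \<le> C * norm y"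
    "\<And>b. b \<in> B \<Longrightarrow> bounded_linear (r b)"
    using finite_dimensional_coordinates[OF assms] by blast
  define q where "q y = (\<Sum>b\<in>B. (r b y)\<^sup>2) / C\<^sup>2" for y
  define D where "D y = (\<Sum>b\<in>B. (2 * r b y / C\<^sup>2) *\<^sub>R Blinfun (r b))" for y
  define A where "A = (\<Sum>b\<in>B. (norm b)\<^sup>2)"
  have A: "A \<ge> 0" by (simp add: A_def sum_nonneg)
  show ?thesis
  proof (rule that)
    \<comment> \<open>The factor \<open>A * C\<^sup>2\<close> comes from Cauchy-Schwarz; the added 1
      keeps the denominator positive when \<open>A\<close> is 0.\<close>
    show "1 / (A * C\<^sup>2 + 1) > 0" using A by (simp add: add_nonneg_pos)
    show "(q has_derivative blinfun_apply (D y)) (at y)" for y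
    proof -
      have "((\<lambda>y. (r b y)\<^sup>2 / C\<^sup>2) has_derivative (\<lambda>h. 2 * r b y / C\<^sup>2 * r b h)) (at y)" if "b \<in> B" for b
      proof -
        have "((\<lambda>t. t\<^sup>2 / C\<^sup>2) has_field_derivative 2 * r b y / C\<^sup>2) (at (r b y))"
          by (rule DERIV_cdivide) (auto intro!: derivative_eq_intros)
        with has_derivative_compose[OF bounded_linear_imp_has_derivative[OF B(5)[OF that]]]
        show ?thesis unfolding has_field_derivative_def by blast
      qed
      then have "(q has_derivative (\<lambda>h. \<Sum>b\<in>B. 2 * r b y / C\<^sup>2 * r b h)) (at y)"
        unfolding q_def sum_divide_distrib by (rule has_derivative_sum)
      moreover have "blinfun_apply (D y) = (\<lambda>h. \<Sum>b\<in>B. 2 * r b y / C\<^sup>2 * r b h)"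
        by (simp add: D_def blinfun.sum_left blinfun.scaleR_left bounded_linear_Blinfun_apply B(5)
            fun_eq_iff)
      ultimately show ?thesis by simp
    qed
    have "continuous_on UNIV (r b)" if "b \<in> B" for b
      using B(5)[OF that] by (rule linear_continuous_on)
    then show "continuous_on UNIV D"
      unfolding D_def using B(2)
      by (intro continuous_on_sum continuous_on_scaleR continuous_on_divide continuous_on_mult
          continuous_on_const) auto
    show "q y \<le> (norm y)\<^sup>2" for y
    proof -
      have "(\<Sum>b\<in>B. (r b y)\<^sup>2) \<le> (\<Sum>b\<in>B. \<bar>r b y\<bar>)\<^sup>2"
        using power_mono[OF L2_set_le_sum_abs, of "\<lambda>b. r b y" B 2]
        by (simp add: L2_set_def sum_nonneg)
      also have "\<dots> \<le> (C * norm y)\<^sup>2" using B(4) by (intro power_mono sum_nonneg) auto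
      finally show ?thesis
        using B(2) by (simp add: q_def pos_divide_le_eq power_mult_distrib mult.commute)
    qed
    show "1 / (A * C\<^sup>2 + 1) * (norm y)\<^sup>2 \<le> q y" for y
    proof -
      have q: "q y \<ge> 0" by (simp add: q_def sum_nonneg)
      have "norm y \<le> (\<Sum>b\<in>B. \<bar>r b y\<bar> * norm b)"
        by (subst B(3)[of y, symmetric]) (rule order_trans[OF norm_sum], simp)
      then have "(norm y)\<^sup>2 \<le> (\<Sum>b\<in>B. \<bar>r b y\<bar> * norm b)\<^sup>2" by (intro power_mono) auto
      also have "\<dots> \<le> (\<Sum>b\<in>B. \<bar>r b y\<bar>\<^sup>2) * A"
        unfolding A_def by (rule Cauchy_Schwarz_ineq_sum)
      also have "\<dots> = (A * C\<^sup>2) * q y" using B(2) by (simp add: q_def)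
      also have "\<dots> \<le> (A * C\<^sup>2 + 1) * q y" using q by (intro mult_right_mono) auto
      finally have "(norm y)\<^sup>2 \<le> q y * (A * C\<^sup>2 + 1)" by (simp add: mult.commute)
      then show ?thesis using A by (simp add: pos_divide_le_eq add_nonneg_pos)
    qed
  qed
qed

section \<open>Continuously differentiable cutoff functions\<close>

definition C1_function :: "('a::real_normed_vector \<Rightarrow> real) \<Rightarrow> bool" where
  "C1_function f \<longleftrightarrow> (\<forall>y. f differentiable (at y)) \<and> continuous_on UNIV (Diff f)"

lemma C1_functionI:
  assumes "\<And>y. (f has_derivative blinfun_apply (D y)) (at y)" "continuous_on UNIV D"
  shows "C1_function f"
proof -
  have "Diff f = D" using Diff_eq[OF assms(1)] by blast
  then show ?thesis using assms by (auto simp: C1_function_def differentiable_def)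
qed

lemma C1_function_diff:
  assumes "C1_function f" "C1_function g"
  shows "C1_function (\<lambda>y. f y - g y)"
proof (rule C1_functionI)
  show "((\<lambda>y. f y - g y) has_derivative blinfun_apply (Diff f y - Diff g y)) (at y)" for y
    using has_derivative_diff[OF has_derivative_Diff has_derivative_Diff, of f y g] assms
    by (simp add: C1_function_def minus_blinfun.rep_eq)
  show "continuous_on UNIV (\<lambda>y. Diff f y - Diff g y)"
    using assms by (auto simp: C1_function_def intro: continuous_on_diff)
qed

lemma C1_function_const: "C1_function (\<lambda>y. c)"
  by (rule C1_functionI[where D = "\<lambda>y. 0"]) (simp_all add: zero_blinfun.rep_eq)

lemma Diff_eq_0_if_locally_constant:
  assumes "open S" "y \<in> S" "\<And>z. z \<in> S \<Longrightarrow> f z = c"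
  shows "Diff f y = 0"
proof (rule Diff_eq)
  have "((\<lambda>z. c) has_derivative (\<lambda>h. 0)) (at y)" by simp
  from has_derivative_transform_within_open[OF this assms(1,2)] assms(3)
  show "(f has_derivative blinfun_apply 0) (at y)" by (simp add: zero_blinfun.rep_eq)
qed

text \<open>At 0 the difference quotient is bounded by \<open>\<bar>h\<bar>\<close>; elsewhere the
  function agrees near \<open>t\<close> with the square or with 0. This is the building block of the
  \<open>C1_function\<close> cutoffs.\<close>

lemma has_field_derivative_max_0_square:
  "((\<lambda>t. (max 0 t)\<^sup>2) has_field_derivative 2 * max 0 t) (at (t::real))"
proof (cases "t = 0")
  case True
  have "((\<lambda>h. (max 0 h)\<^sup>2 / h) \<longlongrightarrow> (0::real)) (at 0)"
  proof (rule Lim_null_comparison)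
    show "((\<lambda>h. \<bar>h\<bar>) \<longlongrightarrow> (0::real)) (at 0)"
      using tendsto_rabs_zero[OF tendsto_ident_at] by simp
    show "\<forall>\<^sub>F h in at 0. norm ((max 0 h)\<^sup>2 / h) \<le> \<bar>h::real\<bar>"
      by (rule always_eventually) (auto simp: max_def power2_eq_square)
  qed
  then show ?thesis using True by (simp add: has_field_derivative_iff)
next
  case False
  show ?thesis
  proof (cases "t > 0")
    case True
    have "((\<lambda>t. t\<^sup>2) has_field_derivative 2 * max 0 t) (at t)"
      using True by (auto intro!: derivative_eq_intros)
    then show ?thesis
      by (rule has_field_derivative_transform_within_open[where S = "{0<..}"]) (use True in auto)
  next
    case False
    with \<open>t \<noteq> 0\<close> have t: "t < 0" by simp
    have "((\<lambda>t. 0) has_field_derivative 2 * max 0 t) (at t)" using t by simp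
    then show ?thesis
      by (rule has_field_derivative_transform_within_open[where S = "{..<0}"]) (use t in auto)
  qed
qed

text \<open>Two nested truncated squares: the inner one is 0 for \<open>t \<le> 0\<close> and at
  least 1 for \<open>t \<ge> 1\<close>, where the outer truncation cuts it off.\<close>

lemma smooth_step:
  obtains g g' :: "real \<Rightarrow> real" where
    "\<And>t. (g has_field_derivative g' t) (at t)" "continuous_on UNIV g'"
    "\<And>t. t \<le> 0 \<Longrightarrow> g t = 0" "\<And>t. t \<ge> 1 \<Longrightarrow> g t = 1" "\<And>t. 0 \<le> g t" "\<And>t. g t \<le> 1"
proof
  let ?m = "\<lambda>t::real. (max 0 t)\<^sup>2"
  let ?g = "\<lambda>t. 1 - ?m (1 - ?m t)"
  let ?g' = "\<lambda>t. 2 * max 0 (1 - ?m t) * (2 * max 0 t)"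
  show "(?g has_field_derivative ?g' t) (at t)" for t
    using DERIV_diff[OF DERIV_const[of 1] DERIV_chain2[OF has_field_derivative_max_0_square
      DERIV_diff[OF DERIV_const[of 1] has_field_derivative_max_0_square]]] by simp
  show "continuous_on UNIV ?g'" by (intro continuous_intros)
  show "?g t = 0" if "t \<le> 0" for t using that by (simp add: max_def)
  show "?g t = 1" if "t \<ge> 1" for t
  proof -
    have "max 0 (1 - (max 0 t)\<^sup>2) = 0" using one_le_power[OF that, of 2] that by simp
    then show ?thesis by simp
  qed
  show "?g t \<ge> 0" for t by (simp add: power_le_one)
  show "?g t \<le> 1" for t by simp
qed

text \<open>The step function is composed with \<open>q y - r\<^sup>2\<close>. The upper bound on
  \<open>q\<close> makes the result vanish on the ball of radius \<open>r\<close>, the lower bound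
  makes it 1 far out.\<close>

lemma C1_cutoff:
  assumes "\<exists>B :: 'a::real_normed_vector set. finite B \<and> span B = UNIV"
  obtains \<psi> :: "'a::real_normed_vector \<Rightarrow> real" and R where "C1_function \<psi>"
    "\<And>y. 0 \<le> \<psi> y" "\<And>y. \<psi> y \<le> 1"
    "\<And>y. norm y \<le> r \<Longrightarrow> \<psi> y = 0" "\<And>y. norm y > R \<Longrightarrow> \<psi> y = 1"
proof -
  obtain q :: "'a \<Rightarrow> real" and D c where q: "c > 0"
    "\<And>y. (q has_derivative blinfun_apply (D y)) (at y)" "continuous_on UNIV D"
    "\<And>y. q y \<le> (norm y)\<^sup>2" "\<And>y. c * (norm y)\<^sup>2 \<le> q y"
    using finite_dimensional_quadratic[OF assms] by metis
  obtain g g' :: "real \<Rightarrow> real" where g: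
    "\<And>t. (g has_field_derivative g' t) (at t)" "continuous_on UNIV g'"
    "\<And>t. t \<le> 0 \<Longrightarrow> g t = 0" "\<And>t. t \<ge> 1 \<Longrightarrow> g t = 1" "\<And>t. 0 \<le> g t" "\<And>t. g t \<le> 1"
    using smooth_step by metis
  let ?\<psi> = "\<lambda>y. g (q y - r\<^sup>2)"
  show ?thesis
  proof (rule that)
    show "C1_function ?\<psi>"
    proof (rule C1_functionI)
      show "(?\<psi> has_derivative blinfun_apply (g' (q y - r\<^sup>2) *\<^sub>R D y)) (at y)" for y
      proof -
        have "((\<lambda>y. q y - r\<^sup>2) has_derivative blinfun_apply (D y)) (at y)"
          by (auto intro!: derivative_eq_intros q(2))
        from has_derivative_compose[OF this g(1)[unfolded has_field_derivative_def]]
        show ?thesis by (simp add: scaleR_blinfun.rep_eq)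
      qed
      have "continuous_on UNIV q"
        using q(2) by (meson continuous_at_imp_continuous_on has_derivative_continuous)
      then have "continuous_on UNIV (\<lambda>y. g' (q y - r\<^sup>2))"
        by (intro continuous_on_compose2[OF g(2)] continuous_intros) auto
      then show "continuous_on UNIV (\<lambda>y. g' (q y - r\<^sup>2) *\<^sub>R D y)"
        by (intro continuous_on_scaleR q(3))
    qed
    show "?\<psi> y = 0" if "norm y \<le> r" for y
      using power_mono[OF that norm_ge_zero, of 2] q(4)[of y] by (intro g(3)) simp
    \<comment> \<open>Beyond this radius the lower bound on \<open>q\<close> yields
      \<open>q y - r\<^sup>2 \<ge> 1\<close>, where the step has reached 1.\<close>
    show "?\<psi> y = 1" if y: "norm y > sqrt ((r\<^sup>2 + 1) / c)" for y
    proof -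
      have "(sqrt ((r\<^sup>2 + 1) / c))\<^sup>2 \<le> (norm y)\<^sup>2"
        using y q(1) by (intro power_mono real_sqrt_ge_zero) auto
      then have "r\<^sup>2 + 1 \<le> c * (norm y)\<^sup>2" using q(1) by (simp add: field_simps)
      then show ?thesis using q(5)[of y] by (intro g(4)) linarith
    qed
  qed (simp_all add: g(5,6))
qed

text \<open>The functions are differences of consecutive cutoffs, so their partial sums telescope to
  \<open>\<psi> 0 y - \<psi> n y\<close>, which is 1 on the ball of radius \<open>n\<close>.\<close>

lemma C1_partition_of_unity:
  assumes "\<exists>B :: 'a::real_normed_vector set. finite B \<and> span B = UNIV"
  obtains \<theta> :: "nat \<Rightarrow> 'a::real_normed_vector \<Rightarrow> real" and R where "\<And>i. C1_function (\<theta> i)"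
    "\<And>i. R i \<ge> 0" "\<And>i y. \<bar>\<theta> i y\<bar> \<le> 1" "\<And>y. norm y \<le> 1 \<Longrightarrow> \<theta> 0 y = 1"
    "\<And>i y. i \<ge> 1 \<Longrightarrow> norm y \<le> real i \<Longrightarrow> \<theta> i y = 0" "\<And>i y. norm y > R i \<Longrightarrow> \<theta> i y = 0"
    "\<And>n y. norm y \<le> real n \<Longrightarrow> n \<ge> 1 \<Longrightarrow> (\<Sum>i<n. \<theta> i y) = 1"
proof -
  have "\<exists>\<psi> :: 'a \<Rightarrow> real. \<exists>R. C1_function \<psi> \<and> (\<forall>y. 0 \<le> \<psi> y \<and> \<psi> y \<le> 1) \<and>
     (\<forall>y. norm y \<le> real i \<longrightarrow> \<psi> y = 0) \<and> (\<forall>y. norm y > R \<longrightarrow> \<psi> y = 1)" for i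
    using C1_cutoff[OF assms, of "real i"] by metis
  then obtain \<phi> :: "nat \<Rightarrow> 'a \<Rightarrow> real" and Q where \<phi>: "\<And>i. C1_function (\<phi> i)"
    "\<And>i y. 0 \<le> \<phi> i y" "\<And>i y. \<phi> i y \<le> 1"
    "\<And>i y. norm y \<le> real i \<Longrightarrow> \<phi> i y = 0" "\<And>i y. norm y > Q i \<Longrightarrow> \<phi> i y = 1"
    by metis
  \<comment> \<open>The constant 1 at index 0 starts the telescope at 1 and makes
    \<open>\<theta> 0\<close> equal to 1 on the unit ball.\<close>
  define \<psi> where "\<psi> i = (if i = 0 then \<lambda>y. 1 else \<phi> i)" for i
  have \<psi>: "C1_function (\<psi> i)" "0 \<le> \<psi> i y" "\<psi> i y \<le> 1" "norm y > Q i \<Longrightarrow> \<psi> i y = 1"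
    "i \<ge> 1 \<Longrightarrow> norm y \<le> real i \<Longrightarrow> \<psi> i y = 0" for i y
    using \<phi> by (auto simp: \<psi>_def C1_function_const)
  define \<theta> where "\<theta> i y = \<psi> i y - \<psi> (Suc i) y" for i y
  \<comment> \<open>The maximum with 0 makes \<open>E_on (R i)\<close> one of the spaces generating
    \<open>E_topology\<close>, where only radii \<open>s \<ge> 0\<close> occur.\<close>
  define R where "R i = max 0 (max (Q i) (Q (Suc i)))" for i
  show ?thesis
  proof (rule that)
    show "C1_function (\<theta> i)" for i
      unfolding \<theta>_def by (intro C1_function_diff \<psi>)
    show "R i \<ge> 0" for i by (simp add: R_def)
    show "\<bar>\<theta> i y\<bar> \<le> 1" for i y
      using \<psi>(2,3)[of i y] \<psi>(2,3)[of "Suc i" y] by (simp add: \<theta>_def)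
    show "\<theta> 0 y = 1" if "norm y \<le> 1" for y
      using that \<psi>(5)[of 1 y] by (simp add: \<theta>_def) (simp add: \<psi>_def)
    show "\<theta> i y = 0" if "i \<ge> 1" "norm y \<le> real i" for i y
      using that \<psi>(5)[of i y] \<psi>(5)[of "Suc i" y] by (simp add: \<theta>_def)
    show "\<theta> i y = 0" if "norm y > R i" for i y
      using that \<psi>(4)[of i y] \<psi>(4)[of "Suc i" y] by (simp add: \<theta>_def R_def)
    show "(\<Sum>i<n. \<theta> i y) = 1" if "norm y \<le> real n" "n \<ge> 1" for n y
    proof -
      have "(\<Sum>i<n. \<theta> i y) = \<psi> 0 y - \<psi> n y" unfolding \<theta>_def by (rule sum_lessThan_telescope')
      then show ?thesis using \<psi>(5)[OF that(2,1)] by (simp add: \<psi>_def)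
    qed
  qed
qed

section \<open>Cutting off functions with compactly supported derivative\<close>

text \<open>Along the ray through \<open>y\<close> the derivative of \<open>\<gamma>\<close> is at
  most \<open>\<eta> / (norm y * t\<^sup>2)\<close>, with antiderivative
  \<open>- \<eta> / (norm y * t)\<close>. Since this bound is integrable at infinity, the estimate
  does not depend on \<open>T\<close>.\<close>

lemma radial_difference_bound:
  assumes diff: "\<And>z. \<gamma> differentiable (at z)" and y: "y \<noteq> 0" and T: "T > 1"
    and bound: "\<And>z. norm z > norm y \<Longrightarrow> norm (Diff \<gamma> z) \<le> \<eta> / (norm z)\<^sup>2" and \<eta>: "\<eta> \<ge> 0"
  shows "\<bar>\<gamma> y - \<gamma> (T *\<^sub>R y)\<bar> \<le> \<eta> / norm y"
proof -
  have f': "((\<lambda>t. \<gamma> (t *\<^sub>R y)) has_vector_derivative Diff \<gamma> (t *\<^sub>R y) y) (at t)" for t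
  proof -
    have "((\<lambda>t. t *\<^sub>R y) has_derivative (\<lambda>t. t *\<^sub>R y)) (at t)" by (auto intro!: derivative_eq_intros)
    from has_derivative_compose[OF this has_derivative_Diff[OF diff]]
    show ?thesis by (simp add: has_vector_derivative_def blinfun.scaleR_right)
  qed
  have \<phi>': "((\<lambda>t. - \<eta> / (norm y * t)) has_vector_derivative \<eta> / (norm y * t\<^sup>2)) (at t)"
    if "t \<ge> 1" for t
    using that y unfolding has_real_derivative_iff_has_vector_derivative[symmetric]
    by (auto intro!: derivative_eq_intros simp: field_simps power2_eq_square)
  have "norm (\<gamma> (T *\<^sub>R y) - \<gamma> (1 *\<^sub>R y)) \<le> - \<eta> / (norm y * T) - - \<eta> / (norm y * 1)"
  proof (rule differentiable_bound_general[OF T _ _ f' \<phi>'])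
    show "continuous_on {1..T} (\<lambda>t. \<gamma> (t *\<^sub>R y))"
      using f' by (meson continuous_at_imp_continuous_on has_vector_derivative_continuous)
    show "continuous_on {1..T} (\<lambda>t. - \<eta> / (norm y * t))"
      using \<phi>' by (meson continuous_at_imp_continuous_on has_vector_derivative_continuous atLeastAtMost_iff)
    fix t assume t: "1 < t" "t < T"
    have "norm (Diff \<gamma> (t *\<^sub>R y) y) \<le> norm (Diff \<gamma> (t *\<^sub>R y)) * norm y" by (rule norm_blinfun)
    also have "\<dots> \<le> \<eta> / (norm (t *\<^sub>R y))\<^sup>2 * norm y"
      using t y by (intro mult_right_mono bound) auto
    also have "\<dots> = \<eta> / (norm y * t\<^sup>2)" using t y by (simp add: power2_eq_square)
    finally show "norm (Diff \<gamma> (t *\<^sub>R y) y) \<le> \<eta> / (norm y * t\<^sup>2)" .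
  qed simp
  also have "\<dots> \<le> \<eta> / norm y" using y T \<eta> by simp
  finally show ?thesis by (simp add: abs_minus_commute)
qed

lemma Diff_eq_0_outside_spt: "y \<notin> spt (Diff \<gamma>) \<Longrightarrow> Diff \<gamma> y = 0"
  using closure_subset[of "support_on UNIV (Diff \<gamma>)"] by (auto simp: spt_def support_on_def)

lemma spt_subset_cball:
  assumes "\<And>y. norm y > s \<Longrightarrow> f y = 0"
  shows "spt f \<subseteq> cball 0 s"
  unfolding spt_def by (rule closure_minimal) (use assms in \<open>force simp: support_on_def not_less\<close>)+

lemma E_on_Diff_eq_0: "\<gamma> \<in> E_on s \<Longrightarrow> norm y > s \<Longrightarrow> Diff \<gamma> y = 0"
  by (rule Diff_eq_0_outside_spt) (auto simp: E_on_def)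

text \<open>The radial estimate with \<eta> = 0. Its hypothesis concerns only points of norm larger
  than \<open>norm y\<close>, so \<open>norm y = s\<close> is allowed.\<close>

lemma E_on_radially_constant:
  assumes "\<gamma> \<in> E_on s" "norm y \<ge> s" "T > 1" "y \<noteq> 0"
  shows "\<gamma> (T *\<^sub>R y) = \<gamma> y"
proof -
  have "\<bar>\<gamma> y - \<gamma> (T *\<^sub>R y)\<bar> \<le> 0 / norm y"
  proof (rule radial_difference_bound)
    show "norm (Diff \<gamma> z) \<le> 0 / (norm z)\<^sup>2" if "norm z > norm y" for z
      using E_on_Diff_eq_0[OF assms(1), of z] that assms(2) by simp
  qed (use assms in \<open>auto simp: E_on_def\<close>)
  then show ?thesis by simp
qed

text \<open>Subtracting \<open>\<gamma> (T y)\<close>, the value of \<open>\<gamma>\<close> near infinity in the direction of \<open>y\<close>, does not change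
  the derivative away from \<open>0\<close>, and makes the factor of \<open>Diff \<theta>\<close> small.
  This also works in dimension one, where \<open>\<gamma>\<close> has two limits at infinity.\<close>

lemma localize_E_on:
  fixes \<gamma> \<theta> :: "'a::real_normed_vector \<Rightarrow> real"
  assumes \<gamma>: "\<gamma> \<in> E_on s" and T: "T > s" "T > 1" and \<theta>: "C1_function \<theta>"
    and e: "\<And>y. norm y \<le> 1 \<Longrightarrow> \<theta> y = e" and R: "\<And>y. norm y > R \<Longrightarrow> \<theta> y = 0"
  defines "P \<equiv> \<lambda>y. \<theta> y * (\<gamma> y - \<gamma> (T *\<^sub>R y)) + e * \<gamma> (T *\<^sub>R y)"
  shows "P \<in> E_on R"
    and "Diff P y = \<theta> y *\<^sub>R Diff \<gamma> y + (\<gamma> y - \<gamma> (T *\<^sub>R y)) *\<^sub>R Diff \<theta> y"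
proof -
  have d\<gamma>: "(\<gamma> has_derivative blinfun_apply (Diff \<gamma> y)) (at y)" for y
    using \<gamma> by (intro has_derivative_Diff) (simp add: E_on_def)
  have d\<theta>: "(\<theta> has_derivative blinfun_apply (Diff \<theta> y)) (at y)" for y
    using \<theta> by (intro has_derivative_Diff) (simp add: C1_function_def)
  have d\<gamma>T: "((\<lambda>y. \<gamma> (T *\<^sub>R y)) has_derivative (\<lambda>h. T * Diff \<gamma> (T *\<^sub>R y) h)) (at y)" for y
  proof -
    have "((\<lambda>y. T *\<^sub>R y) has_derivative (\<lambda>h. T *\<^sub>R h)) (at y)" by (auto intro!: derivative_eq_intros)
    from has_derivative_compose[OF this d\<gamma>] show ?thesis by (simp add: blinfun.scaleR_right)
  qed
  \<comment> \<open>By the product rule, the derivative of \<gamma> at \<open>T *\<^sub>R y\<close>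
    enters the derivative of \<open>P\<close> with the factor \<open>e - \<theta> y\<close>. That
    factor is 0 on the unit ball, where \<open>P\<close> is just \<open>e\<close> times \<gamma>;
    outside it, \<open>T *\<^sub>R y\<close> has norm larger than \<open>s\<close>.\<close>
  have far: "(e - \<theta> y) * (T * Diff \<gamma> (T *\<^sub>R y) h) = 0" for y h
  proof (cases "norm y \<le> 1")
    case False
    then have "T * norm y > s" using T by (smt (verit) mult_less_cancel_left2)
    then show ?thesis using E_on_Diff_eq_0[OF \<gamma>, of "T *\<^sub>R y"] T by (simp add: zero_blinfun.rep_eq)
  qed (simp add: e)
  let ?D = "\<lambda>y. \<theta> y *\<^sub>R Diff \<gamma> y + (\<gamma> y - \<gamma> (T *\<^sub>R y)) *\<^sub>R Diff \<theta> y"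
  have dP: "(P has_derivative blinfun_apply (?D y)) (at y)" for y
  proof -
    have "(P has_derivative (\<lambda>h. (\<theta> y * (Diff \<gamma> y h - T * Diff \<gamma> (T *\<^sub>R y) h)
        + Diff \<theta> y h * (\<gamma> y - \<gamma> (T *\<^sub>R y))) + e * (T * Diff \<gamma> (T *\<^sub>R y) h))) (at y)"
      unfolding P_def
      by (intro has_derivative_add has_derivative_mult has_derivative_diff has_derivative_mult_right
          d\<gamma> d\<theta> d\<gamma>T)
    moreover have "(\<theta> y * (Diff \<gamma> y h - T * Diff \<gamma> (T *\<^sub>R y) h)
        + Diff \<theta> y h * (\<gamma> y - \<gamma> (T *\<^sub>R y))) + e * (T * Diff \<gamma> (T *\<^sub>R y) h) = blinfun_apply (?D y) h" for h
    proof -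
      have "(\<theta> y * (Diff \<gamma> y h - T * Diff \<gamma> (T *\<^sub>R y) h)
        + Diff \<theta> y h * (\<gamma> y - \<gamma> (T *\<^sub>R y))) + e * (T * Diff \<gamma> (T *\<^sub>R y) h)
        = blinfun_apply (?D y) h + (e - \<theta> y) * (T * Diff \<gamma> (T *\<^sub>R y) h)"
        by (simp add: blinfun.add_left blinfun.diff_left blinfun.scaleR_left algebra_simps)
      then show ?thesis using far[of y h] by simp
    qed
    ultimately show ?thesis by simp
  qed
  show DP: "Diff P y = ?D y" for y by (rule Diff_eq[OF dP])
  have ct: "continuous_on UNIV \<gamma>" "continuous_on UNIV \<theta>" "continuous_on UNIV (\<lambda>y. \<gamma> (T *\<^sub>R y))"
    using d\<gamma> d\<theta> d\<gamma>T by (meson continuous_at_imp_continuous_on has_derivative_continuous)+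
  have "continuous_on UNIV ?D"
    using ct \<gamma> \<theta> by (intro continuous_intros) (auto simp: E_on_def C1_function_def)
  with dP have C1: "C1_function P" by (rule C1_functionI)
  have "Diff P y = 0" if y: "norm y > R" for y
  proof -
    have "Diff \<theta> y = 0"
      using y R by (intro Diff_eq_0_if_locally_constant[of "- cball 0 R" y \<theta> 0]) auto
    then show ?thesis using R[OF y] by (simp add: DP)
  qed
  then have "spt (Diff P) \<subseteq> cball 0 R" by (rule spt_subset_cball)
  moreover have "P 0 = 0" using \<gamma> by (simp add: P_def E_on_def)
  ultimately show "P \<in> E_on R" using C1 by (simp add: E_on_def C1_function_def)
qed

section \<open>Locally convex topologies\<close>

lemma norm_onD:
  assumes "norm_on V N"
  shows "subspace V" and "x \<in> V \<Longrightarrow> 0 \<le> N x" and "x \<in> V \<Longrightarrow> N (c *\<^sub>R x) = \<bar>c\<bar> * N x"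
    and "x \<in> V \<Longrightarrow> y \<in> V \<Longrightarrow> N (x + y) \<le> N x + N y"
    and "x \<in> V \<Longrightarrow> y \<in> V \<Longrightarrow> x - y \<in> V" and "N 0 = 0"
    and "x \<in> V \<Longrightarrow> y \<in> V \<Longrightarrow> N (x - y) = N (y - x)"
proof -
  show V: "subspace V" and "x \<in> V \<Longrightarrow> 0 \<le> N x" and sc: "\<And>c x. x \<in> V \<Longrightarrow> N (c *\<^sub>R x) = \<bar>c\<bar> * N x"
    and "x \<in> V \<Longrightarrow> y \<in> V \<Longrightarrow> N (x + y) \<le> N x + N y"
    using assms by (auto simp: norm_on_def)
  show d: "x \<in> V \<Longrightarrow> y \<in> V \<Longrightarrow> x - y \<in> V" for x y by (rule subspace_diff[OF V])
  show "N 0 = 0" using sc[OF subspace_0[OF V], of 0] by simp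
  show "x \<in> V \<Longrightarrow> y \<in> V \<Longrightarrow> N (x - y) = N (y - x)" using sc[OF d[of x y], of "-1"] by simp
qed

lemma openin_norm_topology:
  assumes "norm_on V N"
  shows "openin (norm_topology V N) U \<longleftrightarrow>
    U \<subseteq> V \<and> (\<forall>x\<in>U. \<exists>r>0. \<forall>y\<in>V. N (y - x) < r \<longrightarrow> y \<in> U)"
proof -
  interpret Metric_space V "\<lambda>x y. if x \<in> V \<and> y \<in> V then N (x - y) else 0"
    by (rule norm_on_Metric_space[OF assms])
  have "mball x r \<subseteq> U \<longleftrightarrow> (\<forall>y\<in>V. N (y - x) < r \<longrightarrow> y \<in> U)" if "x \<in> V" for x r
    using that norm_onD(7)[OF assms that] by (auto simp: subset_iff)
  then show ?thesis
    unfolding norm_topology_def openin_mtopology by (meson subsetD)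
qed

lemma openin_norm_ball:
  assumes N: "norm_on V N" and x: "x \<in> V"
  shows "openin (norm_topology V N) {y \<in> V. N (y - x) < r}"
  unfolding openin_norm_topology[OF N]
proof (intro conjI ballI)
  fix z assume z: "z \<in> {y \<in> V. N (y - x) < r}"
  have "N (y - x) < r" if "y \<in> V" "N (y - z) < r - N (z - x)" for y
    using norm_onD(4)[OF N, of "y - z" "z - x"] norm_onD(5)[OF N] that z x by auto
  then show "\<exists>d>0. \<forall>y\<in>V. N (y - z) < d \<longrightarrow> y \<in> {y \<in> V. N (y - x) < r}"
    using z by (intro exI[of _ "r - N (z - x)"]) auto
qed auto

lemma continuous_map_norm_topology:
  assumes N: "norm_on V N" and M: "norm_on W M" and f: "\<And>x. x \<in> V \<Longrightarrow> f x \<in> W"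
    and C: "\<And>x y. x \<in> V \<Longrightarrow> y \<in> V \<Longrightarrow> M (f y - f x) \<le> C * N (y - x)"
  shows "continuous_map (norm_topology V N) (norm_topology W M) f"
  unfolding continuous_map topspace_norm_topology[OF N] topspace_norm_topology[OF M]
proof (intro conjI allI impI)
  show "f ` V \<subseteq> W" using f by auto
  fix U assume U: "openin (norm_topology W M) U"
  show "openin (norm_topology V N) {x \<in> V. f x \<in> U}"
    unfolding openin_norm_topology[OF N]
  proof (intro conjI ballI)
    fix x assume x: "x \<in> {x \<in> V. f x \<in> U}"
    then obtain r where r: "r > 0" "\<And>z. z \<in> W \<Longrightarrow> M (z - f x) < r \<Longrightarrow> z \<in> U"
      using U unfolding openin_norm_topology[OF M] by blast
    \<comment> \<open>The divisor \<open>\<bar>C\<bar> + 1\<close> is positive for every real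
      \<open>C\<close>.\<close>
    have "f y \<in> U" if y: "y \<in> V" "N (y - x) < r / (\<bar>C\<bar> + 1)" for y
    proof (rule r(2)[OF f[OF y(1)]])
      have nn: "0 \<le> N (y - x)" using x y norm_onD(2,5)[OF N] by simp
      have "M (f y - f x) \<le> C * N (y - x)" using C x y by simp
      also have "\<dots> \<le> (\<bar>C\<bar> + 1) * N (y - x)" by (intro mult_right_mono nn) auto
      also have "\<dots> < r" using y(2) by (simp add: pos_less_divide_eq mult.commute)
      finally show "M (f y - f x) < r" .
    qed
    then show "\<exists>d>0. \<forall>y\<in>V. N (y - x) < d \<longrightarrow> y \<in> {x \<in> V. f x \<in> U}"
      using r(1) by (intro exI[of _ "r / (\<bar>C\<bar> + 1)"]) auto
  qed auto
qed

text \<open>Norm topologies serve as competitors in the definition of a finest locally convex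
  topology: if all inclusions are continuous for a norm, its balls are open in the finest
  topology.\<close>

lemma locally_convex_on_norm_topology:
  assumes N: "norm_on V N"
  shows "locally_convex_on V (norm_topology V N)"
  unfolding locally_convex_on_def topological_vector_space_on_def
proof (intro conjI)
  let ?T = "norm_topology V N"
  note V = norm_onD(1)[OF N] and nn = norm_onD(2)[OF N] and sc = norm_onD(3)[OF N]
    and tri = norm_onD(4)[OF N] and diff = norm_onD(5)[OF N]
  have ball: "openin ?T {y \<in> V. N (y - x) < r}" if "x \<in> V" for x r by (rule openin_norm_ball[OF N that])
  show "subspace V" by (rule V)
  show tT: "topspace ?T = V" by (rule topspace_norm_topology[OF N])
  show "continuous_map (prod_topology ?T ?T) ?T (\<lambda>(x, y). x + y)"
    unfolding continuous_map
  proof (intro conjI allI impI)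
    show "(\<lambda>(x, y). x + y) ` topspace (prod_topology ?T ?T) \<subseteq> topspace ?T"
      using subspace_add[OF V] by (auto simp: tT)
    fix U assume U: "openin ?T U"
    show "openin (prod_topology ?T ?T) {x \<in> topspace (prod_topology ?T ?T). (case x of (x, y) \<Rightarrow> x + y) \<in> U}"
      unfolding openin_prod_topology_alt
    proof (intro allI impI)
      fix x y assume "(x, y) \<in> {x \<in> topspace (prod_topology ?T ?T). (case x of (x, y) \<Rightarrow> x + y) \<in> U}"
      then have xy: "x \<in> V" "y \<in> V" "x + y \<in> U" by (auto simp: tT)
      then obtain r where r: "r > 0" "\<And>z. z \<in> V \<Longrightarrow> N (z - (x + y)) < r \<Longrightarrow> z \<in> U"
        using U unfolding openin_norm_topology[OF N] by blast
      have "x' + y' \<in> U" if "x' \<in> V" "y' \<in> V" "N (x' - x) < r / 2" "N (y' - y) < r / 2" for x' y'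
      proof (rule r(2))
        show "x' + y' \<in> V" using that subspace_add[OF V] by blast
        show "N (x' + y' - (x + y)) < r"
          using tri[OF diff[of x' x] diff[of y' y]] that xy by (simp add: algebra_simps)
      qed
      then show "\<exists>A B. openin ?T A \<and> openin ?T B \<and> x \<in> A \<and> y \<in> B \<and>
          A \<times> B \<subseteq> {x \<in> topspace (prod_topology ?T ?T). (case x of (x, y) \<Rightarrow> x + y) \<in> U}"
        using ball[OF xy(1), of "r / 2"] ball[OF xy(2), of "r / 2"] xy(1,2) r(1) norm_onD(6)[OF N]
        by (intro exI[of _ "{z \<in> V. N (z - x) < r / 2}"] exI[of _ "{z \<in> V. N (z - y) < r / 2}"])
          (auto simp: tT)
    qed
  qed
  show "continuous_map (prod_topology euclideanreal ?T) ?T (\<lambda>(c, x). c *\<^sub>R x)"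
    unfolding continuous_map
  proof (intro conjI allI impI)
    show "(\<lambda>(c, x). c *\<^sub>R x) ` topspace (prod_topology euclideanreal ?T) \<subseteq> topspace ?T"
      using subspace_scale[OF V] by (auto simp: tT)
    fix U assume U: "openin ?T U"
    show "openin (prod_topology euclideanreal ?T)
        {x \<in> topspace (prod_topology euclideanreal ?T). (case x of (c, x) \<Rightarrow> c *\<^sub>R x) \<in> U}"
      unfolding openin_prod_topology_alt
    proof (intro allI impI)
      fix c x assume "(c, x) \<in> {x \<in> topspace (prod_topology euclideanreal ?T). (case x of (c, x) \<Rightarrow> c *\<^sub>R x) \<in> U}"
      then have x: "x \<in> V" "c *\<^sub>R x \<in> U" by (auto simp: tT)
      then obtain r where r: "r > 0" "\<And>z. z \<in> V \<Longrightarrow> N (z - c *\<^sub>R x) < r \<Longrightarrow> z \<in> U"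
        using U unfolding openin_norm_topology[OF N] by blast
      \<comment> \<open>The difference \<open>c' *\<^sub>R x' - c *\<^sub>R x\<close> splits into
        \<open>c' *\<^sub>R (x' - x)\<close> and \<open>(c' - c) *\<^sub>R x\<close>; the radii
        allot \<open>r / 2\<close> to each. The bound \<open>a \<le> 1\<close> keeps
        \<open>\<bar>c'\<bar>\<close> below \<open>\<bar>c\<bar> + 1\<close>.\<close>
      define a where "a = min 1 (r / (2 * (N x + 1)))"
      define b where "b = r / (2 * (\<bar>c\<bar> + 1))"
      have ab: "a > 0" "b > 0" using r nn[OF x(1)] by (auto simp: a_def b_def)
      have "c' *\<^sub>R x' \<in> U" if that: "x' \<in> V" "\<bar>c' - c\<bar> < a" "N (x' - x) < b" for c' x'
      proof (rule r(2))
        show "c' *\<^sub>R x' \<in> V" using that subspace_scale[OF V] by blast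
        have "N (c' *\<^sub>R x' - c *\<^sub>R x) = N (c' *\<^sub>R (x' - x) + (c' - c) *\<^sub>R x)"
          by (simp add: algebra_simps)
        also have "\<dots> \<le> N (c' *\<^sub>R (x' - x)) + N ((c' - c) *\<^sub>R x)"
          using that x diff subspace_scale[OF V] by (intro tri) auto
        also have "\<dots> = \<bar>c'\<bar> * N (x' - x) + \<bar>c' - c\<bar> * N x"
          using that x diff by (simp add: sc)
        also have "\<bar>c' - c\<bar> * N x \<le> a * (N x + 1)"
          using that(2) nn[OF x(1)] by (intro mult_mono) auto
        also have "\<dots> \<le> r / 2"
        proof -
          have "a \<le> r / (2 * (N x + 1))" by (simp add: a_def)
          then show ?thesis using nn[OF x(1)] by (simp add: field_simps)
        qed
        also have "\<bar>c'\<bar> * N (x' - x) \<le> (\<bar>c\<bar> + 1) * N (x' - x)"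
          using that(2) nn[OF diff[OF that(1) x(1)]] by (intro mult_right_mono) (auto simp: a_def)
        also have "\<dots> < (\<bar>c\<bar> + 1) * b" using that(3) by (intro mult_strict_left_mono) auto
        also have "(\<bar>c\<bar> + 1) * b = r / 2" by (simp add: b_def field_simps)
        finally show "N (c' *\<^sub>R x' - c *\<^sub>R x) < r" by simp
      qed
      then show "\<exists>A B. openin euclideanreal A \<and> openin ?T B \<and> c \<in> A \<and> x \<in> B \<and>
          A \<times> B \<subseteq> {x \<in> topspace (prod_topology euclideanreal ?T). (case x of (c, x) \<Rightarrow> c *\<^sub>R x) \<in> U}"
        using ball[OF x(1), of b] x ab norm_onD(6)[OF N]
        by (intro exI[of _ "ball c a"] exI[of _ "{z \<in> V. N (z - x) < b}"])
          (auto simp: tT dist_real_def abs_minus_commute)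
    qed
  qed
  show "neighbourhood_base_at 0 convex ?T"
    unfolding neighbourhood_base_at_def
  proof (intro allI impI)
    fix W assume "openin ?T W \<and> 0 \<in> W"
    then obtain r where r: "r > 0" "\<And>y. y \<in> V \<Longrightarrow> N (y - 0) < r \<Longrightarrow> y \<in> W"
      unfolding openin_norm_topology[OF N] by blast
    let ?B = "{y \<in> V. N (y - 0) < r}"
    have "convex ?B"
    proof (rule convexI)
      fix x y and u v :: real assume A: "x \<in> ?B" "y \<in> ?B" "0 \<le> u" "0 \<le> v" "u + v = 1"
      have "N (u *\<^sub>R x + v *\<^sub>R y) \<le> u * N x + v * N y"
        using tri[of "u *\<^sub>R x" "v *\<^sub>R y"] sc[of x u] sc[of y v] A subspace_scale[OF V] by simp
      also have "\<dots> < r" using A by (intro convex_bound_lt) auto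
      finally show "u *\<^sub>R x + v *\<^sub>R y \<in> ?B"
        using A subspace_scale[OF V] subspace_add[OF V] by simp
    qed
    moreover have "openin ?T ?B" by (rule ball[OF subspace_0[OF V]])
    moreover have "0 \<in> ?B" using r(1) subspace_0[OF V] norm_onD(6)[OF N] by simp
    moreover have "?B \<subseteq> W" using r(2) by blast
    ultimately show "\<exists>A C. openin ?T A \<and> convex C \<and> 0 \<in> A \<and> A \<subseteq> C \<and> C \<subseteq> W" by blast
  qed
qed

text \<open>Continuity of the operations can be tested after applying \<open>f\<close>, which
  commutes with them, and the preimage of a convex set under a linear map is convex.\<close>

lemma locally_convex_on_pullback:
  assumes T: "locally_convex_on W T" and V: "subspace V" and f: "\<And>x. x \<in> V \<Longrightarrow> f x \<in> W"
    and add: "\<And>x y. x \<in> V \<Longrightarrow> y \<in> V \<Longrightarrow> f (x + y) = f x + f y"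
    and scale: "\<And>c x. x \<in> V \<Longrightarrow> f (c *\<^sub>R x) = c *\<^sub>R f x"
  shows "locally_convex_on V (pullback_topology V f T)"
  unfolding locally_convex_on_def topological_vector_space_on_def
proof (intro conjI)
  let ?P = "pullback_topology V f T"
  have TT: "topspace T = W" "continuous_map (prod_topology T T) T (\<lambda>(x, y). x + y)"
    "continuous_map (prod_topology euclideanreal T) T (\<lambda>(c, x). c *\<^sub>R x)"
    "neighbourhood_base_at 0 convex T"
    using T by (auto simp: locally_convex_on_def topological_vector_space_on_def)
  show "subspace V" by (rule V)
  show tP: "topspace ?P = V" using f by (auto simp: topspace_pullback_topology TT)
  have cf: "continuous_map ?P T f"
    using continuous_map_pullback[OF continuous_map_id, of V f T] by (simp add: id_def o_def)
  show "continuous_map (prod_topology ?P ?P) ?P (\<lambda>(x, y). x + y)"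
  proof (rule continuous_map_pullback')
    have "continuous_map (prod_topology ?P ?P) (prod_topology T T) (\<lambda>(x, y). (f x, f y))"
      by (simp add: continuous_map_prod_top cf)
    from continuous_map_compose[OF this TT(2)]
    show "continuous_map (prod_topology ?P ?P) T (f \<circ> (\<lambda>(x, y). x + y))"
      by (rule continuous_map_eq) (auto simp: tP add)
  qed (use subspace_add[OF V] in \<open>auto simp: tP\<close>)
  show "continuous_map (prod_topology euclideanreal ?P) ?P (\<lambda>(c, x). c *\<^sub>R x)"
  proof (rule continuous_map_pullback')
    have "continuous_map (prod_topology euclideanreal ?P) (prod_topology euclideanreal T) (\<lambda>(c, x). (id c, f x))"
      by (simp only: continuous_map_prod_top cf continuous_map_id simp_thms)
    from continuous_map_compose[OF this TT(3)]
    show "continuous_map (prod_topology euclideanreal ?P) T (f \<circ> (\<lambda>(c, x). c *\<^sub>R x))"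
      by (rule continuous_map_eq) (auto simp: tP scale)
  qed (use subspace_scale[OF V] in \<open>auto simp: tP\<close>)
  have f0: "f 0 = 0" using scale[OF subspace_0[OF V], of 0] by simp
  show "neighbourhood_base_at 0 convex ?P"
    unfolding neighbourhood_base_at_def
  proof (intro allI impI)
    fix U assume "openin ?P U \<and> 0 \<in> U"
    then obtain U' where U': "openin T U'" "U = f -` U' \<inter> V" "0 \<in> U'"
      using f0 by (auto simp: openin_pullback_topology)
    then have "\<exists>A C. openin T A \<and> convex C \<and> 0 \<in> A \<and> A \<subseteq> C \<and> C \<subseteq> U'"
      using TT(4) by (simp add: neighbourhood_base_at_def)
    then obtain A C where AC: "openin T A" "convex C" "0 \<in> A" "A \<subseteq> C" "C \<subseteq> U'" by blast
    have "convex (f -` C \<inter> V)"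
    proof (rule convexI)
      fix x y and u v :: real
      assume xy: "x \<in> f -` C \<inter> V" "y \<in> f -` C \<inter> V" "0 \<le> u" "0 \<le> v" "u + v = 1"
      then have "f (u *\<^sub>R x + v *\<^sub>R y) = u *\<^sub>R f x + v *\<^sub>R f y"
        using subspace_scale[OF V] by (simp add: add scale)
      then show "u *\<^sub>R x + v *\<^sub>R y \<in> f -` C \<inter> V"
        using xy convexD[OF AC(2)] subspace_scale[OF V] subspace_add[OF V] by simp
    qed
    moreover have "openin ?P (f -` A \<inter> V)" using AC(1) by (auto simp: openin_pullback_topology)
    moreover have "0 \<in> f -` A \<inter> V" using f0 AC(3) subspace_0[OF V] by simp
    moreover have "f -` A \<inter> V \<subseteq> f -` C \<inter> V" "f -` C \<inter> V \<subseteq> U" using AC U' by auto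
    ultimately show "\<exists>A C. openin ?P A \<and> convex C \<and> 0 \<in> A \<and> A \<subseteq> C \<and> C \<subseteq> U" by blast
  qed
qed

text \<open>The universal property: the pullback topology along \<open>f\<close> is locally convex
  and makes all inclusions continuous, so the finest topology refines it, which is continuity of
  \<open>f\<close>.\<close>

lemma continuous_map_finest_locally_convex:
  assumes T: "locally_convex_on W T" and V: "subspace V" and f: "\<And>x. x \<in> V \<Longrightarrow> f x \<in> W"
    and add: "\<And>x y. x \<in> V \<Longrightarrow> y \<in> V \<Longrightarrow> f (x + y) = f x + f y"
    and scale: "\<And>c x. x \<in> V \<Longrightarrow> f (c *\<^sub>R x) = c *\<^sub>R f x"
    and sub: "\<And>S. S \<in> \<S> \<Longrightarrow> topspace S \<subseteq> V" and cont: "\<And>S. S \<in> \<S> \<Longrightarrow> continuous_map S T f"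
  shows "continuous_map (finest_locally_convex V \<S>) T f"
  unfolding continuous_map
proof (intro conjI allI impI)
  let ?F = "finest_locally_convex V \<S>" and ?P = "pullback_topology V f T"
  have tF: "topspace ?F = V"
    using finest_locally_convex(1)[OF V sub] by (simp add: locally_convex_on_def topological_vector_space_on_def)
  have tT: "topspace T = W" using T by (simp add: locally_convex_on_def topological_vector_space_on_def)
  show "f ` topspace ?F \<subseteq> topspace T" using f by (auto simp: tF tT)
  have P: "locally_convex_on V ?P" by (rule locally_convex_on_pullback[OF T V f add scale])
  have "continuous_map S ?P id" if "S \<in> \<S>" for S
    using cont[OF that] sub[OF that] by (intro continuous_map_pullback') auto
  note fine = finest_locally_convex(3)[OF V sub P this]
  fix U assume "openin T U"
  then have "openin ?P (f -` U \<inter> V)" by (auto simp: openin_pullback_topology)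
  from fine[OF _ _ this]
  show "openin ?F {x \<in> topspace ?F. f x \<in> U}" by (simp add: tF vimage_def Int_def conj_commute)
qed

text \<open>Continuity of addition with one argument fixed; it moves neighbourhoods of an arbitrary
  point to 0.\<close>

lemma openin_translation:
  assumes "topological_vector_space_on V T" "openin T U" "a \<in> V"
  shows "openin T {x \<in> V. a + x \<in> U}"
proof -
  have T: "topspace T = V" "continuous_map (prod_topology T T) T (\<lambda>(x, y). x + y)"
    using assms(1) by (auto simp: topological_vector_space_on_def)
  have "continuous_map T (prod_topology T T) (\<lambda>x. (a, x))"
    using assms(3) T(1) by (intro continuous_map_pairedI) (auto simp: continuous_map_const)
  from continuous_map_compose[OF this T(2)] have "continuous_map T T (\<lambda>x. a + x)" by (simp add: o_def)
  from openin_continuous_map_preimage[OF this assms(2)] show ?thesis by (simp add: T(1))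
qed

text \<open>Inside \<open>M\<close> there is a convex set \<open>C\<close> containing an open
  neighbourhood of 0. The thresholds shrink geometrically, so that a sum of small terms is a convex
  combination of points of \<open>C\<close>. They are chosen before the number \<open>n\<close> of
  terms.\<close>

lemma locally_convex_neighbourhood_sums:
  fixes A :: "nat \<Rightarrow> 'v::real_vector set" and N :: "nat \<Rightarrow> 'v \<Rightarrow> real"
  assumes T: "locally_convex_on V T" and M: "neighbourhood_of T 0 M"
    and N: "\<And>i. norm_on (A i) (N i)" and cont: "\<And>i. continuous_map (norm_topology (A i) (N i)) T id"
  obtains \<epsilon> where "\<And>i. \<epsilon> i > 0"
    "\<And>n f. (\<And>i. i < n \<Longrightarrow> f i \<in> A i \<and> N i (f i) \<le> \<epsilon> i) \<Longrightarrow> (\<Sum>i<n. f i) \<in> M"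
proof -
  obtain U where U: "openin T U" "0 \<in> U" "U \<subseteq> M" using M by (auto simp: neighbourhood_of_def)
  have "neighbourhood_base_at 0 convex T" using T by (simp add: locally_convex_on_def)
  then have "\<exists>B C. openin T B \<and> convex C \<and> 0 \<in> B \<and> B \<subseteq> C \<and> C \<subseteq> U"
    using U by (simp add: neighbourhood_base_at_def)
  then obtain B C where BC: "openin T B" "convex C" "0 \<in> B" "B \<subseteq> C" "C \<subseteq> U" by blast
  have "\<exists>r>0. \<forall>x\<in>A i. N i x < r \<longrightarrow> x \<in> B" for i
  proof -
    have "openin (norm_topology (A i) (N i)) {x \<in> A i. x \<in> B}"
      using openin_continuous_map_preimage[OF cont BC(1)] by (simp add: topspace_norm_topology[OF N])
    moreover have "0 \<in> {x \<in> A i. x \<in> B}" using BC(3) subspace_0[OF norm_onD(1)[OF N]] by simp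
    ultimately have "\<exists>r>0. \<forall>y\<in>A i. N i (y - 0) < r \<longrightarrow> y \<in> {x \<in> A i. x \<in> B}"
      unfolding openin_norm_topology[OF N] by blast
    then show ?thesis by auto
  qed
  then obtain r where r: "\<And>i. r i > 0" "\<And>i x. x \<in> A i \<Longrightarrow> N i x < r i \<Longrightarrow> x \<in> B" by metis
  \<comment> \<open>These weights turn the sum into a convex combination of the rescaled terms and \<open>0\<close>.\<close>
  define w :: "nat \<Rightarrow> real" where "w i = (1/2) ^ Suc i" for i
  have w: "w i > 0" for i by (simp add: w_def)
  show ?thesis
  proof (rule that)
    \<comment> \<open>Halving the radius turns the non-strict bound on \<open>N i (f i)\<close> into
      the strict one required by \<open>r\<close>.\<close>
    show "w i * (r i / 2) > 0" for i using r(1) w by simp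
    fix n f assume f: "\<And>i. i < n \<Longrightarrow> f i \<in> A i \<and> N i (f i) \<le> w i * (r i / 2)"
    have g: "(1 / w i) *\<^sub>R f i \<in> C" if "i < n" for i
    proof -
      have "N i ((1 / w i) *\<^sub>R f i) = N i (f i) / w i"
        using norm_onD(3)[OF N, of "f i"] f[OF that] w[of i] by simp
      also have "\<dots> \<le> r i / 2" using f[OF that] w[of i] by (simp add: pos_divide_le_eq mult.commute)
      also have "\<dots> < r i" using r(1) by simp
      finally have "(1 / w i) *\<^sub>R f i \<in> B"
        using f[OF that] subspace_scale[OF norm_onD(1)[OF N]] by (intro r(2)) auto
      then show ?thesis using BC by blast
    qed
    \<comment> \<open>The extra index \<open>n\<close> carries the remaining mass at the point 0, so
      that the weights sum to 1.\<close>
    define u where "u i = (if i < n then w i else (1/2) ^ n)" for i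
    define y where "y i = (if i < n then (1 / w i) *\<^sub>R f i else 0)" for i
    have sum: "(\<Sum>i<n. w i) + (1/2) ^ n = 1" for n
      by (induction n) (auto simp: w_def)
    have "(\<Sum>i\<in>{..n}. u i *\<^sub>R y i) \<in> C"
    proof (rule convex_sum[OF _ BC(2)])
      have "(\<Sum>i<n. u i) = (\<Sum>i<n. w i)" by (simp add: u_def)
      then show "(\<Sum>i\<le>n. u i) = 1" using sum[of n] by (simp add: lessThan_Suc_atMost[symmetric] u_def)
      show "y i \<in> C" for i using g BC by (auto simp: y_def)
    qed (use w in \<open>auto simp: u_def less_imp_le\<close>)
    moreover have "(\<Sum>i\<in>{..n}. u i *\<^sub>R y i) = (\<Sum>i<n. f i)"
      using w by (simp add: lessThan_Suc_atMost[symmetric] u_def y_def less_imp_neq[symmetric])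
    ultimately show "(\<Sum>i<n. f i) \<in> M" using BC U by auto
  qed
qed

section \<open>Weighted supremum norms\<close>

definition weighted_sup_norm :: "('x \<Rightarrow> real) \<Rightarrow> ('x \<Rightarrow> 'z::real_normed_vector) \<Rightarrow> real" where
  "weighted_sup_norm w f = sup_norm (\<lambda>x. w x *\<^sub>R f x)"

lemma K_on_eq_0: "f \<in> K_on K \<Longrightarrow> x \<notin> K \<Longrightarrow> f x = 0"
  using closure_subset[of "support_on UNIV f"] by (auto simp: K_on_def spt_def support_on_def)

lemma norm_le_sup_norm: "bdd_above (range (\<lambda>x. norm (f x))) \<Longrightarrow> norm (f x) \<le> sup_norm f"
  unfolding sup_norm_def by (rule cSUP_upper[OF UNIV_I])

text \<open>Off \<open>K\<close> the function vanishes, and on \<open>K\<close> the weight is at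
  most \<open>B\<close>. The absolute value is there because a bound over an empty \<open>K\<close>
  may be negative.\<close>

lemma weighted_le_sup_norm:
  assumes f: "f \<in> K_on K" "compact K" and w: "\<And>x. w x \<ge> 0" "\<And>x. x \<in> K \<Longrightarrow> w x \<le> B"
  shows "norm (w x *\<^sub>R f x) \<le> \<bar>B\<bar> * sup_norm f"
proof (cases "x \<in> K")
  case True
  then show ?thesis
    using norm_le_sup_norm[OF bdd_above_K_on[OF f], of x] w(1)[of x] w(2)[of x]
    by (auto intro!: mult_mono)
next
  case False
  then show ?thesis using K_on_eq_0[OF f(1)] sup_norm_facts(1)[OF bdd_above_K_on[OF f]] by simp
qed

lemma bdd_above_weighted:
  assumes "f \<in> K_space" and w: "\<And>x. w x \<ge> 0" "\<And>K. compact K \<Longrightarrow> \<exists>B. \<forall>x\<in>K. w x \<le> B"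
  shows "bdd_above (range (\<lambda>x. norm (w x *\<^sub>R f x)))"
proof -
  obtain K where K: "compact K" "f \<in> K_on K" using assms(1) by (auto simp: K_space_def)
  then obtain B where "\<And>x. x \<in> K \<Longrightarrow> w x \<le> B" using w(2) by blast
  from weighted_le_sup_norm[OF K(2,1) w(1) this] show ?thesis by (meson bdd_aboveI2)
qed

text \<open>Boundedness of the weight on compact sets makes the supremum finite, and its positivity
  makes the norm definite.\<close>

lemma norm_on_weighted_sup_norm:
  assumes w: "\<And>x. w x > 0" "\<And>K. compact K \<Longrightarrow> \<exists>B. \<forall>x\<in>K. w x \<le> B"
  shows "norm_on (K_space :: ('x::t2_space \<Rightarrow> 'z::real_normed_vector) set) (weighted_sup_norm w)"
  unfolding norm_on_def weighted_sup_norm_def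
proof (intro conjI allI ballI subspace_K_space impI)
  note bdd = bdd_above_weighted[OF _ less_imp_le[OF w(1)] w(2)]
  fix f :: "'x \<Rightarrow> 'z" assume f: "f \<in> K_space"
  show "0 \<le> sup_norm (\<lambda>x. w x *\<^sub>R f x)" by (rule sup_norm_facts(1)[OF bdd[OF f]])
  show "f = 0" if "sup_norm (\<lambda>x. w x *\<^sub>R f x) = 0"
    using sup_norm_facts(2)[OF bdd[OF f] that] w(1) by (auto simp: fun_eq_iff less_imp_neq[symmetric])
  show "sup_norm (\<lambda>x. w x *\<^sub>R (c *\<^sub>R f) x) = \<bar>c\<bar> * sup_norm (\<lambda>x. w x *\<^sub>R f x)" for c
    using sup_norm_facts(3)[OF bdd[OF f], of c] by (simp add: mult.commute)
  show "sup_norm (\<lambda>x. w x *\<^sub>R (f + g) x) \<le> sup_norm (\<lambda>x. w x *\<^sub>R f x) + sup_norm (\<lambda>x. w x *\<^sub>R g x)"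
    if "g \<in> K_space" for g
    using sup_norm_facts(4)[OF bdd[OF f] bdd[OF that]] by (simp add: scaleR_add_right)
qed

text \<open>On each \<open>K_on K\<close> the weight is bounded, so the inclusion into
  \<open>K_space\<close> with the weighted norm is Lipschitz. Hence the weighted norm topology is an
  admissible competitor and \<open>K_topology\<close> refines it.\<close>

lemma openin_K_topology_weighted_ball:
  fixes f :: "'x::t2_space \<Rightarrow> 'z::real_normed_vector"
  assumes w: "\<And>x. w x > 0" "\<And>K. compact K \<Longrightarrow> \<exists>B. \<forall>x\<in>K. w x \<le> B" and f: "f \<in> K_space"
  shows "openin K_topology {g \<in> K_space. weighted_sup_norm w (g - f) < r}"
  unfolding K_topology_def
proof (rule finest_locally_convex(3)[OF subspace_K_space])
  note N = norm_on_weighted_sup_norm[OF w]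
  show "locally_convex_on K_space (norm_topology (K_space :: ('x \<Rightarrow> 'z) set) (weighted_sup_norm w))"
    by (rule locally_convex_on_norm_topology[OF N])
  show "openin (norm_topology K_space (weighted_sup_norm w)) {g \<in> K_space. weighted_sup_norm w (g - f) < r}"
    by (rule openin_norm_ball[OF N f])
  fix S :: "('x \<Rightarrow> 'z) topology" assume "S \<in> (\<lambda>K. norm_topology (K_on K) sup_norm) ` Collect compact"
  then obtain K :: "'x set" where K: "compact K" and S: "S = norm_topology (K_on K) sup_norm" by blast
  show "topspace S \<subseteq> K_space"
    using K by (auto simp: S topspace_norm_topology[OF norm_on_K_on] K_space_def)
  obtain B where B: "\<And>x. x \<in> K \<Longrightarrow> w x \<le> B" using w(2)[OF K] by blast
  show "continuous_map S (norm_topology K_space (weighted_sup_norm w)) id"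
    unfolding S
  proof (rule continuous_map_norm_topology[OF norm_on_K_on[OF K] N])
    show "id g \<in> K_space" if "g \<in> K_on K" for g :: "'x \<Rightarrow> 'z" using that K by (auto simp: K_space_def)
    show "weighted_sup_norm w (id h - id g) \<le> \<bar>B\<bar> * sup_norm (h - g)"
      if "g \<in> K_on K" "h \<in> K_on K" for g h :: "'x \<Rightarrow> 'z"
    proof -
      have "h - g \<in> K_on K" using that subspace_K_on subspace_diff by blast
      note le = weighted_le_sup_norm[OF this K less_imp_le[OF w(1)] B]
      have "weighted_sup_norm w (h - g) \<le> \<bar>B\<bar> * sup_norm (h - g)"
        unfolding weighted_sup_norm_def sup_norm_def[of "\<lambda>x. w x *\<^sub>R (h - g) x"]
        by (rule cSUP_least[OF UNIV_not_empty le])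
      then show ?thesis by simp
    qed
  qed
qed

section \<open>The embedding and the neighbourhoods of zero\<close>

lemma E_space_Diff:
  fixes \<gamma> \<delta> :: "'a::real_normed_vector \<Rightarrow> real"
  assumes "\<gamma> \<in> E_space" "\<delta> \<in> E_space"
  shows "Diff (\<gamma> + \<delta>) = Diff \<gamma> + Diff \<delta>" and "Diff (c *\<^sub>R \<gamma>) = c *\<^sub>R Diff \<gamma>"
    and "Diff (\<gamma> - \<delta>) = Diff \<gamma> - Diff \<delta>"
proof -
  have d: "\<And>y. \<gamma> differentiable (at y)" "\<And>y. \<delta> differentiable (at y)"
    using assms by (auto simp: E_space_def E_on_def)
  show add: "Diff (\<gamma> + \<delta>) = Diff \<gamma> + Diff \<delta>" using Diff_linear(1)[OF d] by (simp add: plus_fun_def)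
  show "Diff (c *\<^sub>R \<gamma>) = c *\<^sub>R Diff \<gamma>" using Diff_linear(2)[OF d] by (simp add: scaleR_fun_def)
  have d': "(- 1) *\<^sub>R \<delta> \<in> E_space" using subspace_scale[OF subspace_E_space assms(2)] .
  have "\<gamma> differentiable (at y)" "((- 1) *\<^sub>R \<delta>) differentiable (at y)" for y
    using assms(1) d' unfolding E_space_def E_on_def by blast+
  from Diff_linear(1)[OF this] have "Diff (\<gamma> + (- 1) *\<^sub>R \<delta>) = Diff \<gamma> + Diff ((- 1) *\<^sub>R \<delta>)"
    by (simp add: plus_fun_def)
  also have "Diff ((- 1) *\<^sub>R \<delta>) = (- 1) *\<^sub>R Diff \<delta>" 
    using Diff_linear(2)[OF d(2) d(2), of "- 1"] by (simp only: scaleR_fun_def)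
  finally show "Diff (\<gamma> - \<delta>) = Diff \<gamma> - Diff \<delta>"
    by (simp only: scaleR_minus1_left add_uminus_conv_diff)
qed

lemma Diff_in_K_space:
  fixes \<gamma> :: "'a::real_normed_vector \<Rightarrow> real"
  assumes "\<And>s. compact (cball (0::'a) s)" "\<gamma> \<in> E_space"
  shows "Diff \<gamma> \<in> K_space"
  using assms Diff_E_on by (auto simp: E_space_def K_space_def)

text \<open>This is the definiteness of the norm on \<open>E_on s\<close>: a function with zero
  derivative is constant, and it is normalised to vanish at 0.\<close>

lemma inj_on_Diff_E_space:
  assumes "\<And>s. compact (cball (0::'a::real_normed_vector) s)"
  shows "inj_on Diff (E_space :: ('a \<Rightarrow> real) set)"
proof (rule inj_onI)
  fix \<gamma> \<delta> :: "'a \<Rightarrow> real" assume *: "\<gamma> \<in> E_space" "\<delta> \<in> E_space" "Diff \<gamma> = Diff \<delta>"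
  then have "Diff (\<gamma> - \<delta>) = 0" by (simp add: E_space_Diff(3))
  then have "sup_norm (Diff (\<gamma> - \<delta>)) = 0" by (simp add: sup_norm_def)
  moreover obtain s where "\<gamma> - \<delta> \<in> E_on s"
    using subspace_diff[OF subspace_E_space *(1,2)] by (auto simp: E_space_def)
  moreover have "\<forall>x\<in>E_on s. sup_norm (Diff x) = 0 \<longrightarrow> x = (0 :: 'a \<Rightarrow> real)"
    using norm_on_E_on[OF assms, of s] unfolding norm_on_def by blast
  ultimately have "\<gamma> - \<delta> = 0" by blast
  then show "\<gamma> = \<delta>" by simp
qed

text \<open>By the universal property it suffices to consider each \<open>E_on s\<close>, which
  \<open>Diff\<close> maps isometrically into \<open>K_on (cball 0 s)\<close>.\<close>

lemma continuous_map_Diff: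
  assumes cpt: "\<And>s. compact (cball (0::'a::real_normed_vector) s)"
  shows "continuous_map (E_topology :: ('a \<Rightarrow> real) topology) K_topology Diff"
  unfolding E_topology_def
proof (rule continuous_map_finest_locally_convex[where W = K_space])
  have tK: "topspace S \<subseteq> K_space" if "S \<in> (\<lambda>K. norm_topology (K_on K) sup_norm) ` Collect compact"
    for S :: "('a \<Rightarrow> 'a \<Rightarrow>\<^sub>L real) topology"
    using that by (auto simp: topspace_norm_topology[OF norm_on_K_on] K_space_def)
  show "locally_convex_on K_space (K_topology :: ('a \<Rightarrow> 'a \<Rightarrow>\<^sub>L real) topology)"
    unfolding K_topology_def by (rule finest_locally_convex(1)[OF subspace_K_space tK])
  fix S :: "('a \<Rightarrow> real) topology"
  assume "S \<in> (\<lambda>s. norm_topology (E_on s) (\<lambda>\<gamma>. sup_norm (Diff \<gamma>))) ` {0..}"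
  then obtain s where s: "s \<ge> 0" and S: "S = norm_topology (E_on s) (\<lambda>\<gamma>. sup_norm (Diff \<gamma>))" by auto
  have E: "E_on s \<subseteq> (E_space :: ('a \<Rightarrow> real) set)" using s by (auto simp: E_space_def)
  then show "topspace S \<subseteq> E_space" by (simp add: S topspace_norm_topology[OF norm_on_E_on[OF cpt]])
  have "continuous_map S (norm_topology (K_on (cball 0 s)) sup_norm) Diff"
    unfolding S
  proof (rule continuous_map_norm_topology[OF norm_on_E_on[OF cpt] norm_on_K_on[OF cpt]])
    show "sup_norm (Diff \<delta> - Diff \<gamma>) \<le> 1 * sup_norm (Diff (\<delta> - \<gamma>))"
      if "\<gamma> \<in> E_on s" "\<delta> \<in> E_on s" for \<gamma> \<delta> :: "'a \<Rightarrow> real"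
    proof -
      have "\<gamma> \<in> E_space" "\<delta> \<in> E_space" using that E by blast+
      then show ?thesis by (simp add: E_space_Diff(3))
    qed
  qed (rule Diff_E_on)
  moreover have "continuous_map (norm_topology (K_on (cball 0 s)) sup_norm)
      (K_topology :: ('a \<Rightarrow> 'a \<Rightarrow>\<^sub>L real) topology) id"
    unfolding K_topology_def
    by (rule finest_locally_convex(2)[OF subspace_K_space tK]) (use cpt in blast)+
  ultimately show "continuous_map S K_topology Diff"
    using continuous_map_compose[of S _ Diff K_topology id] by simp
qed (simp_all add: subspace_E_space Diff_in_K_space[OF cpt] E_space_Diff)

lemma E_topology_facts:
  assumes cpt: "\<And>s. compact (cball (0::'a::real_normed_vector) s)"
  shows "locally_convex_on E_space (E_topology :: ('a \<Rightarrow> real) topology)"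
    and "s \<ge> 0 \<Longrightarrow> continuous_map (norm_topology (E_on s) (\<lambda>\<gamma>. sup_norm (Diff \<gamma>)))
           (E_topology :: ('a \<Rightarrow> real) topology) id"
proof -
  have tE: "topspace S \<subseteq> E_space"
    if "S \<in> (\<lambda>s. norm_topology (E_on s) (\<lambda>\<gamma>. sup_norm (Diff \<gamma>))) ` {0..}" for S :: "('a \<Rightarrow> real) topology"
    using that by (auto simp: topspace_norm_topology[OF norm_on_E_on[OF cpt]] E_space_def)
  show "locally_convex_on E_space (E_topology :: ('a \<Rightarrow> real) topology)"
    unfolding E_topology_def by (rule finest_locally_convex(1)[OF subspace_E_space tE])
  show "continuous_map (norm_topology (E_on s) (\<lambda>\<gamma>. sup_norm (Diff \<gamma>)))
           (E_topology :: ('a \<Rightarrow> real) topology) id" if "s \<ge> 0"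
    unfolding E_topology_def
    by (rule finest_locally_convex(2)[OF subspace_E_space tE]) (use that in auto)
qed

section \<open>Weights dominating the conditions in \<open>W_set\<close>\<close>

definition W_weight :: "(nat \<Rightarrow> nat) \<Rightarrow> 'a::real_normed_vector \<Rightarrow> real" where
  "W_weight \<alpha> y = 1 + (\<Sum>i\<le>Suc (nat \<lceil>norm y\<rceil>). real (\<alpha> i))"

lemma W_weight_pos: "W_weight \<alpha> y > 0"
  unfolding W_weight_def by (intro add_pos_nonneg sum_nonneg) auto

text \<open>The indices with \<open>real i - 1 < norm y\<close> all occur in the sum. As \<alpha>
  need not be monotone, the sum is used as a locally bounded majorant of all these values.\<close>

lemma W_weight_ge:
  assumes "norm y > real i - 1" shows "real (\<alpha> i) \<le> W_weight \<alpha> y"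
proof -
  have "i \<le> Suc (nat \<lceil>norm y\<rceil>)" using assms by linarith
  then have "real (\<alpha> i) \<le> (\<Sum>i\<le>Suc (nat \<lceil>norm y\<rceil>). real (\<alpha> i))" by (intro member_le_sum) auto
  then show ?thesis by (simp add: W_weight_def)
qed

lemma W_weight_bounded_on_compact:
  assumes "compact K" shows "\<exists>B. \<forall>y\<in>K. W_weight \<alpha> y \<le> B"
proof -
  obtain b where b: "\<And>y. y \<in> K \<Longrightarrow> norm y \<le> b" using compact_imp_bounded[OF assms] by (auto simp: bounded_iff)
  have "W_weight \<alpha> y \<le> 1 + (\<Sum>i\<le>Suc (nat \<lceil>b\<rceil>). real (\<alpha> i))" if "y \<in> K" for y
  proof -
    have "nat \<lceil>norm y\<rceil> \<le> nat \<lceil>b\<rceil>" using b[OF that] by (intro nat_mono ceiling_mono)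
    then show ?thesis unfolding W_weight_def by (intro add_left_mono sum_mono2) auto
  qed
  then show ?thesis by blast
qed

lemma weighted_ball_subset_W_set:
  fixes \<gamma> :: "'a::real_normed_vector \<Rightarrow> real"
  assumes cpt: "\<And>s. compact (cball (0::'a) s)" and \<gamma>: "\<gamma> \<in> E_space" and \<alpha>: "\<alpha> \<in> {1..} \<rightarrow> {1..}"
    and less: "weighted_sup_norm (W_weight \<alpha>) (Diff \<gamma>) < 1"
  shows "\<gamma> \<in> W_set \<alpha>"
  unfolding W_set_def
proof (intro CollectI conjI allI impI \<gamma>)
  fix i :: nat and y :: 'a assume i: "1 \<le> i" and y: "real i - 1 < norm y"
  have "real (\<alpha> i) * norm (Diff \<gamma> y) \<le> W_weight \<alpha> y * norm (Diff \<gamma> y)"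
    by (intro mult_right_mono W_weight_ge y) auto
  also have "\<dots> \<le> weighted_sup_norm (W_weight \<alpha>) (Diff \<gamma>)"
    using norm_le_sup_norm[OF bdd_above_weighted[OF Diff_in_K_space[OF cpt \<gamma>]
        less_imp_le[OF W_weight_pos] W_weight_bounded_on_compact], of \<alpha> y] W_weight_pos[of \<alpha> y]
    by (simp add: weighted_sup_norm_def)
  finally have "real (\<alpha> i) * norm (Diff \<gamma> y) \<le> 1" using less by simp
  moreover have "\<alpha> i \<ge> 1" using \<alpha> i by auto
  ultimately show "norm (Diff \<gamma> y) \<le> inverse (real (\<alpha> i))" by (simp add: field_simps)
qed

text \<open>The condition in \<open>W_set\<close> at index \<open>Suc i\<close> speaks of points
  with \<open>norm y > i\<close>. Continuity of \<open>Diff \<gamma>\<close> extends it to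
  \<open>norm y = i\<close> by approximation from outside.\<close>

lemma W_set_bound:
  fixes u y :: "'a::real_normed_vector"
  assumes \<gamma>: "\<gamma> \<in> W_set \<alpha>" and i: "real i \<le> norm y" and u: "u \<noteq> 0"
  shows "norm (Diff \<gamma> y) \<le> inverse (real (\<alpha> (Suc i)))"
proof -
  \<comment> \<open>The point is pushed outward along its own ray; at the origin the nonzero vector
    \<open>u\<close> supplies a direction.\<close>
  define v where "v = (if y = 0 then u else y)"
  define z where "z n = y + inverse (real (Suc n)) *\<^sub>R v" for n
  have "(\<lambda>n. y + inverse (real (Suc n)) *\<^sub>R v) \<longlonglongrightarrow> y + 0 *\<^sub>R v"
    by (intro tendsto_intros LIMSEQ_inverse_real_of_nat)
  then have "z \<longlonglongrightarrow> y" by (simp add: z_def[abs_def])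
  moreover have "isCont (Diff \<gamma>) y"
    using \<gamma> by (auto simp: W_set_def E_space_def E_on_def continuous_on_eq_continuous_at)
  ultimately have lim: "(\<lambda>n. norm (Diff \<gamma> (z n))) \<longlonglongrightarrow> norm (Diff \<gamma> y)"
    by (intro tendsto_norm isCont_tendsto_compose[of y "Diff \<gamma>"])
  have "norm (z n) > real i" for n
  proof (cases "y = 0")
    case True
    then show ?thesis using i u by (simp add: z_def v_def)
  next
    case False
    then have "z n = (1 + inverse (real (Suc n))) *\<^sub>R y" by (simp add: z_def v_def scaleR_add_left)
    then have "norm (z n) = (1 + inverse (real (Suc n))) * norm y" by simp
    moreover have "1 * norm y < (1 + inverse (real (Suc n))) * norm y"
      using False by (intro mult_strict_right_mono) auto
    ultimately show ?thesis using i by simp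
  qed
  then have "norm (Diff \<gamma> (z n)) \<le> inverse (real (\<alpha> (Suc i)))" for n
    using \<gamma> by (auto simp: W_set_def)
  then show ?thesis by (intro LIMSEQ_le_const2[OF lim]) auto
qed

section \<open>Every neighbourhood of zero contains some \<open>W_set \<alpha>\<close>\<close>

lemma sum_fun_apply: "(\<Sum>i\<in>A. f i) x = (\<Sum>i\<in>A. f i x)"
  by (induction A rule: infinite_finite_induct) (auto simp: zero_fun_def)

text \<open>The neighbourhood and the partition of unity determine the thresholds \<epsilon> and
  then \<alpha>. Only afterwards is \<gamma> given, and with it the dilation \<open>T\<close> and
  the number \<open>n\<close> of pieces; the bounds on the pieces depend on neither.\<close>

lemma W_set_subset_neighbourhood:
  fixes u :: "'a::real_normed_vector"
  assumes fin: "\<exists>B :: 'a set. finite B \<and> span B = UNIV" and u: "u \<noteq> 0"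
    and M: "neighbourhood_of (E_topology :: ('a \<Rightarrow> real) topology) 0 M"
  shows "\<exists>\<alpha>\<in>{1..} \<rightarrow> {1..}. W_set \<alpha> \<subseteq> M"
proof -
  note cpt = compact_cball_finite_dimensional[OF fin]
  obtain \<theta> :: "nat \<Rightarrow> 'a \<Rightarrow> real" and R where \<theta>: "\<And>i. C1_function (\<theta> i)"
    "\<And>i. R i \<ge> 0" "\<And>i y. \<bar>\<theta> i y\<bar> \<le> 1" "\<And>y. norm y \<le> 1 \<Longrightarrow> \<theta> 0 y = 1"
    "\<And>i y. i \<ge> 1 \<Longrightarrow> norm y \<le> real i \<Longrightarrow> \<theta> i y = 0" "\<And>i y. norm y > R i \<Longrightarrow> \<theta> i y = 0"
    "\<And>n y. norm y \<le> real n \<Longrightarrow> n \<ge> 1 \<Longrightarrow> (\<Sum>i<n. \<theta> i y) = 1"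
    by (rule C1_partition_of_unity[OF fin]) blast
  obtain \<epsilon> :: "nat \<Rightarrow> real" where \<epsilon>: "\<And>i. \<epsilon> i > 0" "\<And>n f. (\<And>i. i < n \<Longrightarrow> f i \<in> E_on (R i) \<and>
      sup_norm (Diff (f i)) \<le> \<epsilon> i) \<Longrightarrow> (\<Sum>i<n. f i) \<in> M"
    using locally_convex_neighbourhood_sums[where A = "\<lambda>i. E_on (R i)" and
        N = "\<lambda>i \<gamma>. sup_norm (Diff \<gamma>)", OF E_topology_facts(1)[OF cpt] M norm_on_E_on[OF cpt]
        E_topology_facts(2)[OF cpt \<theta>(2)]] by metis
  have "\<exists>L\<ge>0. \<forall>y. norm (Diff (\<theta> i) y) \<le> L" for i
  proof -
    have "Diff (\<theta> i) y = 0" if "norm y > R i" for y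
      using that \<theta>(6) by (intro Diff_eq_0_if_locally_constant[of "- cball 0 (R i)" y "\<theta> i" 0]) auto
    then have "Diff (\<theta> i) \<in> K_on (cball 0 (R i))"
      using \<theta>(1)[of i] spt_subset_cball by (auto simp: K_on_def C1_function_def)
    note bdd = bdd_above_K_on[OF this cpt]
    show ?thesis using norm_le_sup_norm[OF bdd] sup_norm_facts(1)[OF bdd] by blast
  qed
  then obtain L where L: "\<And>i. L i \<ge> 0" "\<And>i y. norm (Diff (\<theta> i) y) \<le> L i" by metis
  \<comment> \<open>Chosen so that \<open>\<eta> i + \<eta> i * L i = \<epsilon> i\<close>: the
    first term bounds the part with \<open>Diff \<gamma>\<close>, the second the part with
    \<open>Diff (\<theta> i)\<close>.\<close>
  define \<eta> where "\<eta> i = \<epsilon> i / (1 + L i)" for i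
  have \<eta>: "\<eta> i > 0" for i using \<epsilon>(1)[of i] L(1)[of i] by (simp add: \<eta>_def add_pos_nonneg)
  \<comment> \<open>One value \<open>\<alpha> j\<close> has to exceed
    \<open>(real j)\<^sup>2 / \<eta> i\<close> for all \<open>i < j\<close>; the sum of the ceilings
    does so, and the leading 1 makes it positive.\<close>
  define \<alpha> where "\<alpha> j = 1 + (\<Sum>i<j. nat \<lceil>(real j)\<^sup>2 / \<eta> i\<rceil>)" for j
  have \<alpha>: "inverse (real (\<alpha> j)) \<le> \<eta> i / (real j)\<^sup>2" if "i < j" for i j
  proof -
    have "nat \<lceil>(real j)\<^sup>2 / \<eta> i\<rceil> \<le> (\<Sum>i<j. nat \<lceil>(real j)\<^sup>2 / \<eta> i\<rceil>)"
      using that by (intro member_le_sum) auto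
    then have "(real j)\<^sup>2 / \<eta> i \<le> real (\<alpha> j)" unfolding \<alpha>_def by linarith
    moreover have "(real j)\<^sup>2 / \<eta> i > 0" using that \<eta> by simp
    ultimately have "inverse (real (\<alpha> j)) \<le> inverse ((real j)\<^sup>2 / \<eta> i)" by (intro le_imp_inverse_le)
    then show ?thesis by simp
  qed
  have "W_set \<alpha> \<subseteq> M"
  proof
    fix \<gamma> :: "'a \<Rightarrow> real" assume \<gamma>W: "\<gamma> \<in> W_set \<alpha>"
    then obtain s where \<gamma>: "\<gamma> \<in> E_on s" "s \<ge> 0" by (auto simp: W_set_def E_space_def)
    \<comment> \<open>With \<open>j\<close> the integer part of \<open>norm z\<close>, the bound at
      index \<open>Suc j\<close> applies, and \<open>norm z \<le> Suc j\<close> turns its quadratic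
      decay into decay in \<open>norm z\<close>.\<close>
    have small: "norm (Diff \<gamma> z) \<le> \<eta> i" "z \<noteq> 0 \<Longrightarrow> norm (Diff \<gamma> z) \<le> \<eta> i / (norm z)\<^sup>2"
      if z: "real i \<le> norm z" for i z
    proof -
      define j where "j = nat \<lfloor>norm z\<rfloor>"
      have j: "i \<le> j" "real j \<le> norm z" "norm z \<le> real (Suc j)" using z unfolding j_def by linarith+
      have b: "norm (Diff \<gamma> z) \<le> \<eta> i / (real (Suc j))\<^sup>2"
        using W_set_bound[OF \<gamma>W j(2) u] \<alpha>[of i "Suc j"] j(1) by simp
      also have "\<dots> \<le> \<eta> i / 1" using \<eta>[of i] by (intro divide_left_mono) auto
      finally show "norm (Diff \<gamma> z) \<le> \<eta> i" by simp
      assume "z \<noteq> 0"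
      have "\<eta> i / (real (Suc j))\<^sup>2 \<le> \<eta> i / (norm z)\<^sup>2"
        using \<eta>[of i] j(3) \<open>z \<noteq> 0\<close> by (intro divide_left_mono power_mono mult_pos_pos) auto
      with b show "norm (Diff \<gamma> z) \<le> \<eta> i / (norm z)\<^sup>2" by simp
    qed
    define T where "T = max 2 (s + 1)"
    have T: "T > s" "T > 1" by (auto simp: T_def)
    \<comment> \<open>The constant value of \<open>\<theta> i\<close> on the unit ball, hence the
      coefficient of the correction term.\<close>
    define e :: "nat \<Rightarrow> real" where "e i = (if i = 0 then 1 else 0)" for i
    have e: "\<theta> i y = e i" if "norm y \<le> 1" for i y
      using that \<theta>(4)[of y] \<theta>(5)[of i y] by (auto simp: e_def)
    define P where "P i = (\<lambda>y. \<theta> i y * (\<gamma> y - \<gamma> (T *\<^sub>R y)) + e i * \<gamma> (T *\<^sub>R y))" for i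
    have P: "P i \<in> E_on (R i)"
      and DP: "Diff (P i) y = \<theta> i y *\<^sub>R Diff \<gamma> y + (\<gamma> y - \<gamma> (T *\<^sub>R y)) *\<^sub>R Diff (\<theta> i) y" for i y
      unfolding P_def using localize_E_on[where \<theta> = "\<theta> i" and e = "e i" and R = "R i", OF \<gamma>(1) T \<theta>(1) e \<theta>(6)]
      by blast+
    have "norm (Diff (P i) y) \<le> \<epsilon> i" for i y
    proof -
      have 1: "norm (\<theta> i y *\<^sub>R Diff \<gamma> y) \<le> \<eta> i"
      proof (cases "real i \<le> norm y")
        case True
        have "\<bar>\<theta> i y\<bar> * norm (Diff \<gamma> y) \<le> 1 * \<eta> i"
          by (intro mult_mono \<theta>(3) small[OF True]) auto
        then show ?thesis by simp
      next
        case False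
        then have "i \<ge> 1" by (cases i) auto
        then have "\<theta> i y = 0" using False by (intro \<theta>(5)) auto
        then show ?thesis using \<eta>[of i] by simp
      qed
      have 2: "norm ((\<gamma> y - \<gamma> (T *\<^sub>R y)) *\<^sub>R Diff (\<theta> i) y) \<le> \<eta> i * L i"
      proof -
        \<comment> \<open>In the first two regions \<open>\<theta> i\<close> is locally constant, so
          the term vanishes. In the third, \<open>1 \<le> norm y\<close> turns the radial bound
          \<open>\<eta> i / norm y\<close> into \<open>\<eta> i\<close>.\<close>
        consider "norm y < 1" | "i \<ge> 1" "norm y < real i" | "1 \<le> norm y" "real i \<le> norm y"
          by (cases i) force+
        then show ?thesis
        proof cases
          case 1
          then have "Diff (\<theta> i) y = 0"
            using e by (intro Diff_eq_0_if_locally_constant[of "ball 0 1" y _ "e i"]) auto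
          then show ?thesis using \<eta>[of i] L(1)[of i] by simp
        next
          case 2
          then have "Diff (\<theta> i) y = 0"
            using \<theta>(5) by (intro Diff_eq_0_if_locally_constant[of "ball 0 (real i)" y _ 0]) auto
          then show ?thesis using \<eta>[of i] L(1)[of i] by simp
        next
          case 3
          then have y: "y \<noteq> 0" by auto
          have "\<bar>\<gamma> y - \<gamma> (T *\<^sub>R y)\<bar> \<le> \<eta> i / norm y"
          proof (rule radial_difference_bound[OF _ y T(2)])
            show "norm (Diff \<gamma> z) \<le> \<eta> i / (norm z)\<^sup>2" if "norm z > norm y" for z
              using that 3 by (intro small(2)) auto
          qed (use \<gamma>(1) \<eta>[of i] in \<open>auto simp: E_on_def\<close>)
          also have "\<dots> \<le> \<eta> i / 1" using 3 \<eta>[of i] by (intro divide_left_mono) auto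
          finally have "\<bar>\<gamma> y - \<gamma> (T *\<^sub>R y)\<bar> * norm (Diff (\<theta> i) y) \<le> \<eta> i * L i"
            using \<eta>[of i] L(2) by (intro mult_mono) auto
          then show ?thesis by simp
        qed
      qed
      have "norm (Diff (P i) y) \<le> \<eta> i + \<eta> i * L i" unfolding DP by (rule norm_triangle_mono[OF 1 2])
      also have "\<dots> = \<eta> i * (1 + L i)" by (simp add: distrib_left)
      also have "\<dots> = \<epsilon> i" using L(1)[of i] by (simp add: \<eta>_def add_nonneg_eq_0_iff)
      finally show ?thesis .
    qed
    then have sP: "sup_norm (Diff (P i)) \<le> \<epsilon> i" for i
      unfolding sup_norm_def by (intro cSUP_least) auto
    \<comment> \<open>Within radius \<open>n\<close> the functions \<theta> sum to 1. Beyond it,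
      \<open>n \<ge> s\<close> gives \<open>\<gamma> (T *\<^sub>R y) = \<gamma> y\<close>, so the
      differences vanish and the correction at index 0, present as \<open>n \<ge> 1\<close>,
      restores \<gamma>.\<close>
    define n where "n = Suc (nat \<lceil>s\<rceil>)"
    have n: "n \<ge> 1" "real n \<ge> s" unfolding n_def by linarith+
    have "(\<Sum>i<n. P i) = \<gamma>"
    proof
      fix y
      have e1: "(\<Sum>i<n. e i) = 1" using n(1) by (simp add: e_def)
      have "(\<Sum>i<n. P i) y = (\<Sum>i<n. \<theta> i y) * (\<gamma> y - \<gamma> (T *\<^sub>R y)) + (\<Sum>i<n. e i) * \<gamma> (T *\<^sub>R y)"
        by (simp add: sum_fun_apply P_def sum.distrib sum_distrib_right)
      also have "\<dots> = \<gamma> y"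
      proof (cases "norm y \<le> real n")
        case True
        then show ?thesis using \<theta>(7)[OF True n(1)] e1 by simp
      next
        case False
        then have "\<gamma> (T *\<^sub>R y) = \<gamma> y"
          using n by (intro E_on_radially_constant[OF \<gamma>(1) _ T(2)]) auto
        then show ?thesis using e1 by simp
      qed
      finally show "(\<Sum>i<n. P i) y = \<gamma> y" .
    qed
    moreover have "(\<Sum>i<n. P i) \<in> M" using P sP by (intro \<epsilon>(2)) auto
    ultimately show "\<gamma> \<in> M" by simp
  qed
  moreover have "\<alpha> \<in> {1..} \<rightarrow> {1..}" by (auto simp: \<alpha>_def)
  ultimately show ?thesis by blast
qed

theorem corollary5p18:
  assumes finite_dim: "\<exists>B :: 'a::banach set. finite B \<and> span B = UNIV"
    and dim: "dim (UNIV :: 'a set) \<ge> 1"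
  shows "embedding_map (E_topology :: ('a \<Rightarrow> real) topology)
           (K_topology :: ('a \<Rightarrow> 'a \<Rightarrow>\<^sub>L real) topology) Diff
       \<and> fundamental_system_of_neighbourhoods (E_topology :: ('a \<Rightarrow> real) topology) 0
           (W_set ` ({1..} \<rightarrow> {1..}))"
proof
  let ?E = "E_topology :: ('a \<Rightarrow> real) topology"
  let ?K = "K_topology :: ('a \<Rightarrow> 'a \<Rightarrow>\<^sub>L real) topology"
  note cpt = compact_cball_finite_dimensional[OF finite_dim]
  \<comment> \<open>A nonzero vector is what allows the origin to be approximated by points of
    positive norm in \<open>W_set_bound\<close>.\<close>
  have "(UNIV :: 'a set) \<noteq> {0}"
  proof
    assume "(UNIV :: 'a set) = {0}"
    then have "UNIV \<subseteq> span ({} :: 'a set)" by simp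
    then have "dim (UNIV :: 'a set) \<le> card ({} :: 'a set)" by (rule dim_le_card) simp
    with dim show False by simp
  qed
  then obtain u :: 'a where u: "u \<noteq> 0" by blast
  have tvs: "topological_vector_space_on E_space ?E"
    using E_topology_facts(1)[OF cpt] by (simp add: locally_convex_on_def)
  then have tE: "topspace ?E = E_space" by (simp add: topological_vector_space_on_def)
  have cont: "continuous_map ?E ?K Diff" by (rule continuous_map_Diff[OF cpt])
  \<comment> \<open>Open balls of the weighted norm around \<open>Diff \<gamma>\<close>: if such a
    ball contains \<open>Diff \<delta>\<close>, then \<open>\<delta> - \<gamma>\<close> lies in
    \<open>W_set \<alpha>\<close>.\<close>
  define G :: "(nat \<Rightarrow> nat) \<Rightarrow> ('a \<Rightarrow> real) \<Rightarrow> ('a \<Rightarrow> 'a \<Rightarrow>\<^sub>L real) set"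
    where "G \<alpha> \<gamma> = {g \<in> K_space. weighted_sup_norm (W_weight \<alpha>) (g - Diff \<gamma>) < 1}" for \<alpha> \<gamma>
  have openG: "openin ?K (G \<alpha> \<gamma>)" if "\<gamma> \<in> E_space" for \<alpha> \<gamma>
    unfolding G_def using W_weight_pos W_weight_bounded_on_compact Diff_in_K_space[OF cpt that]
    by (rule openin_K_topology_weighted_ball)
  have GW: "\<delta> - \<gamma> \<in> W_set \<alpha>" if "\<alpha> \<in> {1..} \<rightarrow> {1..}" "\<gamma> \<in> E_space" "\<delta> \<in> E_space" "Diff \<delta> \<in> G \<alpha> \<gamma>" for \<alpha> \<gamma> \<delta>
    using that by (intro weighted_ball_subset_W_set[OF cpt])
      (auto simp: G_def E_space_Diff(3) subspace_diff[OF subspace_E_space])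
  have self: "Diff \<gamma> \<in> G \<alpha> \<gamma>" if "\<gamma> \<in> E_space" for \<alpha> \<gamma>
    using Diff_in_K_space[OF cpt that] by (simp add: G_def weighted_sup_norm_def sup_norm_def)
  show "embedding_map ?E ?K Diff"
    unfolding embedding_map_def
  proof (rule bijective_open_imp_homeomorphic_map)
    show "continuous_map ?E (subtopology ?K (Diff ` topspace ?E)) Diff"
      using cont by (auto simp: continuous_map_in_subtopology)
    show "Diff ` topspace ?E = topspace (subtopology ?K (Diff ` topspace ?E))"
      using continuous_map_image_subset_topspace[OF cont] by auto
    show "inj_on Diff (topspace ?E)" unfolding tE by (rule inj_on_Diff_E_space[OF cpt])
    show "open_map ?E (subtopology ?K (Diff ` topspace ?E)) Diff"
      unfolding open_map_def
    proof (intro allI impI)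
      fix U assume U: "openin ?E U"
      then have UE: "U \<subseteq> E_space" using openin_subset tE by blast
      \<comment> \<open>Translating \<open>U\<close> by \<open>- \<gamma>\<close> gives a
        neighbourhood of 0, which contains some \<open>W_set \<alpha>\<close>; adding \<gamma> again
        gives the claim.\<close>
      have "\<exists>\<alpha>. \<forall>\<delta>\<in>E_space. Diff \<delta> \<in> G \<alpha> \<gamma> \<longrightarrow> \<delta> \<in> U" if "\<gamma> \<in> U" for \<gamma>
      proof -
        have \<gamma>: "\<gamma> \<in> E_space" using that UE by blast
        have "neighbourhood_of ?E 0 {x \<in> E_space. \<gamma> + x \<in> U}"
          using openin_translation[OF tvs U \<gamma>] subspace_0[OF subspace_E_space] that
          by (auto simp: neighbourhood_of_def tE)
        then obtain \<alpha> where \<alpha>: "\<alpha> \<in> {1..} \<rightarrow> {1..}" "W_set \<alpha> \<subseteq> {x \<in> E_space. \<gamma> + x \<in> U}"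
          using W_set_subset_neighbourhood[OF finite_dim u] by blast
        have "\<delta> \<in> U" if "\<delta> \<in> E_space" "Diff \<delta> \<in> G \<alpha> \<gamma>" for \<delta>
          using GW[OF \<alpha>(1) \<gamma> that] \<alpha>(2) by auto
        then show ?thesis by blast
      qed
      then obtain a where a: "\<And>\<gamma> \<delta>. \<gamma> \<in> U \<Longrightarrow> \<delta> \<in> E_space \<Longrightarrow> Diff \<delta> \<in> G (a \<gamma>) \<gamma> \<Longrightarrow> \<delta> \<in> U" by metis
      \<comment> \<open>The image of \<open>U\<close> is the trace of a union of weighted balls:
        each \<open>Diff \<gamma>\<close> lies in its own ball, and an image point in one of the
        balls comes from \<open>U\<close> by the choice of \<open>a\<close>.\<close>
      have "Diff ` U = (\<Union>\<gamma>\<in>U. G (a \<gamma>) \<gamma>) \<inter> Diff ` topspace ?E"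
        using UE self a by (auto simp: tE)
      moreover have "openin ?K (\<Union>\<gamma>\<in>U. G (a \<gamma>) \<gamma>)" using UE openG by (intro openin_Union) auto
      ultimately show "openin (subtopology ?K (Diff ` topspace ?E)) (Diff ` U)"
        unfolding openin_subtopology by blast
    qed
  qed
  have "neighbourhood_of ?E 0 (W_set \<alpha>)" if "\<alpha> \<in> {1..} \<rightarrow> {1..}" for \<alpha>
    unfolding neighbourhood_of_def
  proof (intro conjI exI)
    have zero: "(0 :: 'a \<Rightarrow> real) \<in> E_space" by (rule subspace_0[OF subspace_E_space])
    show "W_set \<alpha> \<subseteq> topspace ?E" by (auto simp: W_set_def tE)
    show "openin ?E {\<delta> \<in> topspace ?E. Diff \<delta> \<in> G \<alpha> 0}"
      by (rule openin_continuous_map_preimage[OF cont openG[OF zero]])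
    show "0 \<in> {\<delta> \<in> topspace ?E. Diff \<delta> \<in> G \<alpha> 0}" using zero self[OF zero] unfolding tE by blast
    show "{\<delta> \<in> topspace ?E. Diff \<delta> \<in> G \<alpha> 0} \<subseteq> W_set \<alpha>"
      using GW[OF that zero] by (auto simp: tE)
  qed
  then show "fundamental_system_of_neighbourhoods ?E 0 (W_set ` ({1..} \<rightarrow> {1..}))"
    using W_set_subset_neighbourhood[OF finite_dim u]
    by (auto simp: fundamental_system_of_neighbourhoods_def)
qed

end
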